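(* Let $q\in\mathbb{C}$ with $0<|q|<1$ and fix a square root $q^{1/2}$. For every integer $m\ge0$, $$\sum_{n=0}^{\infty}\frac{q^{3n^{2}+(2m+1)n}(-1)^{n}}{(q^{2},-q^{m+1},-q^{m+2};q^{2})_{n}}=\frac{(-1)^{m}q^{-\binom{m}{2}}a_{m}(q)}{(q,q^{4};q^{5})_{\infty}}-\frac{(-1)^{m}q^{-\binom{m}{2}}b_{m}(q)}{(q^{2},q^{3};q^{5})_{\infty}}$$ and $$\sum_{n=0}^{\infty}\frac{q^{(3n^{2}-n)/2+2mn}}{(q,q^{m+1/2},-q^{m+1/2};q)_{n}}=\frac{(-1)^{m}q^{-m(m-1)}}{(q^{2m+1};q^{2})_{\infty}}\left\{\frac{a_{m}(q^{2})}{(q^{2},q^{8};q^{10})_{\infty}}-\frac{b_{m}(q^{2})}{(q^{4},q^{6};q^{10})_{\infty}}\right\}.$$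
   Context: Notation: for a base $p$ with $|p|<1$, $(a;p)_\infty=\prod_{k\ge0}(1-ap^k)$, $(a;p)_n=\prod_{k=0}^{n-1}(1-ap^k)$, and $(a_1,\dots,a_r;p)_n=\prod_i (a_i;p)_n$ (also for $n=\infty$). The Gaussian binomial is $\begin{bmatrix} n\\ k\end{bmatrix}_q=\frac{(q;q)_n}{(q;q)_k(q;q)_{n-k}}$ for integers $0\le k\le n$ and $0$ otherwise. The Schur polynomials are $$a_m(q)=\sum_{j\ge 0} q^{j^2+j}\begin{bmatrix} m-j-2 \\ j\end{bmatrix}_q\ (m\ge 1),\qquad b_m(q)=\sum_{j\ge 0} q^{j^2}\begin{bmatrix} m-j-1 \\ j\end{bmatrix}_q\ (m\ge 0),$$ together with $a_0(q)=1$; thus $a_0=1,\ a_1=0,\ b_0=0,\ b_1=1$. $a_m(q^2),b_m(q^2)$ denote these polynomials with $q$ replaced by $q^2$.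
   Formalization: The first identity is false as printed (m=0: left 1+O(q^4), right 1+q+O(q^2)); it is proved with exponent 3n^2+2mn in place of 3n^2+(2m+1)n and with the right-hand side multiplied by 1/(-q^{m+1};q)_∞. *)

theory Defs
  imports "HOL-Analysis.Analysis"
begin

text \<open>
  The first identity in the source is misprinted: with exponent \<open>3 n\<^sup>2 + (2 m + 1) n\<close>
  on the left and no factor \<open>1 / (- q\<^sup>m\<^sup>+\<^sup>1; q)\<^sub>\<infinity>\<close> on the right, it
  fails already for \<open>m = 0\<close>, where the left-hand side is \<open>1 + O(q\<^sup>4)\<close> and the
  right-hand side \<open>1 + q + O(q\<^sup>2)\<close>. The theorem states it with exponent
  \<open>3 n\<^sup>2 + 2 m n\<close> and with that factor; for \<open>m = 0\<close> this is Rogers' identity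
  (number 19 in Slater's list). The second identity is unchanged.
\<close>

definition qpoch :: "complex \<Rightarrow> complex \<Rightarrow> nat \<Rightarrow> complex" where
  "qpoch a p n = (\<Prod>k<n. 1 - a * p ^ k)"

definition qpoch_inf :: "complex \<Rightarrow> complex \<Rightarrow> complex" where
  "qpoch_inf a p = (\<Prod>k. 1 - a * p ^ k)"

definition qpochs :: "complex list \<Rightarrow> complex \<Rightarrow> nat \<Rightarrow> complex" where
  "qpochs as p n = (\<Prod>a\<leftarrow>as. qpoch a p n)"

definition qpochs_inf :: "complex list \<Rightarrow> complex \<Rightarrow> complex" where
  "qpochs_inf as p = (\<Prod>a\<leftarrow>as. qpoch_inf a p)"

text \<open>
  The arguments are integers because the upper index \<open>m - j - 2\<close> below may be negative;
  in that case the coefficient is 0, also for lower index 0.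
\<close>

definition gauss_binomial :: "complex \<Rightarrow> int \<Rightarrow> int \<Rightarrow> complex" where
  "gauss_binomial q n k =
     (if 0 \<le> k \<and> k \<le> n
      then qpoch q q (nat n) / (qpoch q q (nat k) * qpoch q q (nat (n - k))) else 0)"

text \<open>The terms with \<open>j > m\<close> vanish, so the sums over all \<open>j \<ge> 0\<close> may stop at \<open>m\<close>.\<close>

definition schur_a :: "nat \<Rightarrow> complex \<Rightarrow> complex" where
  "schur_a m q =
     (if m = 0 then 1
      else (\<Sum>j\<le>m. q ^ (j\<^sup>2 + j) * gauss_binomial q (int m - int j - 2) (int j)))"

definition schur_b :: "nat \<Rightarrow> complex \<Rightarrow> complex" where
  "schur_b m q = (\<Sum>j\<le>m. q ^ (j\<^sup>2) * gauss_binomial q (int m - int j - 1) (int j))"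

end

theory Submission
  imports Defs
begin

text \<open>
  Multiply the first series by \<open>(-q\<^bsup>m + 1\<^esup>; q)\<^sub>\<infinity>\<close> and the second one by
  \<open>(q\<^bsup>2m + 1\<^esup>; q\<^sup>2)\<^sub>\<infinity>\<close>. As functions of \<open>m\<close>, both products then satisfy the recurrence
  \<open>f(m) = f(m + 1) + Q\<^bsup>m + 1\<^esup> f(m + 2)\<close>, with \<open>Q = q\<close> and \<open>Q = q\<^sup>2\<close> respectively, because the
  series of the defects telescopes (\<open>alternating_sum_recurrence\<close>, \<open>pentagonal_sum_recurrence\<close>); and
  both tend to 1 as \<open>m \<rightarrow> \<infinity>\<close>. A solution of the recurrence is determined by its limit
  (\<open>rr_recurrence_eqI_limit\<close>), so it remains to identify the solution with limit 1.

  On the other hand the recurrence of the Schur polynomials shows that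
  \<open>(-1)\<^sup>m Q\<^bsup>- m (m - 1) / 2\<^esup> (A a\<^sub>m(Q) - B b\<^sub>m(Q))\<close> is the solution with the initial values \<open>A\<close> and \<open>B\<close>
  (\<open>schur_solution_recurrence\<close>). To connect the behaviour at infinity with the initial values one
  needs one explicit solution for which both are known. It is taken from the classical proof of the
  Rogers--Ramanujan identities: a series that has limit 1, satisfies the recurrence again by
  telescoping (\<open>hw2_sum_recurrence\<close>), and becomes a quotient of a theta series by
  \<open>(Q; Q)\<^sub>\<infinity>\<close> for \<open>m = 0\<close> and \<open>m = 1\<close>. Jacobi's triple product evaluates these two values as
  \<open>A = 1 / (Q, Q\<^sup>4; Q\<^sup>5)\<^sub>\<infinity>\<close> and \<open>B = 1 / (Q\<^sup>2, Q\<^sup>3; Q\<^sup>5)\<^sub>\<infinity>\<close> (\<open>hw_sums_0\<close>).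
\<close>

section \<open>Infinite shifted factorials\<close>

lemma qpoch_0 [simp]: "qpoch a p 0 = 1"
  by (simp add: qpoch_def)

lemma qpoch_Suc: "qpoch a p (Suc n) = qpoch a p n * (1 - a * p ^ n)"
  by (simp add: qpoch_def)

lemma power_ne_1_complex:
  fixes q :: complex
  assumes "norm q < 1" "n > 0"
  shows "q ^ n \<noteq> 1"
proof
  assume "q ^ n = 1"
  hence "norm q ^ n = 1" by (metis norm_one norm_power)
  thus False using assms power_less_one_iff[of "norm q" n] by simp
qed

lemma qpoch_factor_nonzero:
  fixes a p :: complex
  assumes "norm p < 1" "norm a < 1"
  shows "1 - a * p ^ k \<noteq> 0"
proof
  assume "1 - a * p ^ k = 0"
  hence "norm (a * p ^ k) = 1" by (metis eq_iff_diff_eq_0 norm_one)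
  moreover have "norm (a * p ^ k) \<le> norm a * 1"
    unfolding norm_mult norm_power
    using assms by (intro mult_left_mono power_le_one) auto
  ultimately show False using assms by simp
qed

lemma qpoch_nonzero: "norm p < 1 \<Longrightarrow> norm a < 1 \<Longrightarrow> qpoch a p n \<noteq> 0"
  using qpoch_factor_nonzero[of p a] by (simp add: qpoch_def)

lemma convergent_prod_qpoch:
  fixes a p :: complex
  assumes "norm p < 1"
  shows "convergent_prod (\<lambda>k. 1 - a * p ^ k)"
proof -
  have "summable (\<lambda>k. norm a * norm p ^ k)"
    using assms by (intro summable_mult summable_geometric) auto
  moreover have "norm ((1 - a * p ^ k) - 1) = norm a * norm p ^ k" for k
    by (simp add: norm_mult norm_power)
  ultimately have "summable (\<lambda>k. norm ((1 - a * p ^ k) - 1))"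
    by presburger
  thus ?thesis
    by (intro abs_convergent_prod_imp_convergent_prod summable_imp_abs_convergent_prod)
qed

lemma qpoch_tendsto:
  assumes "norm p < 1"
  shows "qpoch a p \<longlonglongrightarrow> qpoch_inf a p"
proof -
  have "(\<lambda>n. qpoch a p (Suc n)) \<longlonglongrightarrow> qpoch_inf a p"
    using convergent_prod_LIMSEQ[OF convergent_prod_qpoch[OF assms, of a]]
    by (simp add: qpoch_def qpoch_inf_def lessThan_Suc_atMost)
  thus ?thesis by (rule LIMSEQ_imp_Suc)
qed

lemma qpoch_inf_split:
  assumes "norm p < 1"
  shows "qpoch_inf a p = qpoch a p n * qpoch_inf (a * p ^ n) p"
  using has_prod_unique[OF has_prod_ignore_initial_segment'[OF convergent_prod_qpoch[OF assms], of a n]]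
  by (simp add: qpoch_def qpoch_inf_def power_add mult_ac)

lemma qpoch_inf_nonzero:
  assumes "norm p < 1" "norm a < 1"
  shows "qpoch_inf a p \<noteq> 0"
  unfolding qpoch_inf_def
  using prodinf_nonzero[OF convergent_prod_qpoch[OF assms(1)]] qpoch_factor_nonzero[OF assms]
  by blast

lemma qpoch_inf_shift_tendsto_1:
  assumes "norm p < 1" "norm a < 1"
  shows "(\<lambda>j. qpoch_inf (a * p ^ j) p) \<longlonglongrightarrow> 1"
proof -
  have "(\<lambda>j. qpoch_inf a p / qpoch a p j) \<longlonglongrightarrow> qpoch_inf a p / qpoch_inf a p"
    by (intro tendsto_intros qpoch_tendsto qpoch_inf_nonzero assms)
  moreover have "qpoch_inf a p / qpoch a p j = qpoch_inf (a * p ^ j) p" for j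
    using qpoch_inf_split[OF assms(1), of a j] qpoch_nonzero[OF assms, of j]
    by (simp add: field_simps)
  ultimately show ?thesis using qpoch_inf_nonzero[OF assms] by simp
qed

lemma inverse_qpoch_bounded:
  assumes "norm p < 1" "norm a < 1"
  obtains C where "C > 0" "\<And>n. norm (1 / qpoch a p n) \<le> C"
proof -
  have "(\<lambda>n. 1 / qpoch a p n) \<longlonglongrightarrow> 1 / qpoch_inf a p"
    by (intro tendsto_intros qpoch_tendsto qpoch_inf_nonzero assms)
  from convergent_imp_Bseq[OF convergentI[OF this]] show ?thesis
    using that unfolding Bseq_def by blast
qed

lemma convergent_norm_bounded:
  fixes X :: "nat \<Rightarrow> complex"
  assumes "X \<longlonglongrightarrow> l"
  obtains C where "C > 0" "\<And>n. norm (X n) \<le> C"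
  using convergent_imp_Bseq[OF convergentI[OF assms]] that unfolding Bseq_def by blast

lemma qpoch_inf_tail_Suc:
  assumes "norm p < 1"
  shows "qpoch_inf a p = (1 - a) * qpoch_inf (a * p) p"
  using qpoch_inf_split[OF assms, of a 1] by (simp add: qpoch_def)

text \<open>
  The three series of the proof have terms bounded by \<open>C r\<^bsup>(m + 1) n\<^esup>\<close> with \<open>r < 1\<close>: the
  geometric series at \<open>m = 0\<close> is a common majorant, and for \<open>m \<rightarrow> \<infinity>\<close> all terms but the one
  with \<open>n = 0\<close> die out, so Tannery's theorem applies.
\<close>

lemma dominated_series:
  fixes f :: "nat \<Rightarrow> nat \<Rightarrow> complex"
  assumes r: "0 \<le> r" "r < 1"
    and bound: "\<And>m n. norm (f m n) \<le> C * r ^ ((m + 1) * n)"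
  shows dominated_series_summable: "summable (f m)"
    and dominated_series_tendsto: "(\<lambda>m. f m 0) \<longlonglongrightarrow> 1 \<Longrightarrow> (\<lambda>m. suminf (f m)) \<longlonglongrightarrow> 1"
proof -
  have C: "C \<ge> 0"
    using order_trans[OF norm_ge_zero bound[of 0 0]] by simp
  have M: "norm (f m n) \<le> C * r ^ n" for m n
  proof -
    have "r ^ ((m + 1) * n) \<le> r ^ n"
      using r by (intro power_decreasing) auto
    thus ?thesis using bound[of m n] C by (meson mult_left_mono order_trans)
  qed
  have sM: "summable (\<lambda>n. C * r ^ n)"
    using r by (intro summable_mult summable_geometric) auto
  show "summable (f m)"
    by (rule summable_comparison_test'[OF sM, of 0]) (use M in auto)
  assume f0: "(\<lambda>m. f m 0) \<longlonglongrightarrow> 1"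
  define b where "b = (\<lambda>n::nat. if n = 0 then 1 else 0 :: complex)"
  have "(\<lambda>m. f m n) \<longlonglongrightarrow> b n" for n
  proof (cases "n = 0")
    case False
    have lim: "(\<lambda>m. C * (r ^ n) ^ Suc m) \<longlonglongrightarrow> C * 0"
      using r False
      by (intro tendsto_mult tendsto_const LIMSEQ_Suc LIMSEQ_realpow_zero)
         (auto simp: power_less_one_iff)
    have le: "norm (f m n) \<le> C * (r ^ n) ^ Suc m" for m
      using bound[of m n] by (metis Suc_eq_plus1 mult.commute power_mult)
    have "(\<lambda>m. f m n) \<longlonglongrightarrow> 0"
      by (rule Lim_null_comparison[OF always_eventually[OF allI[OF le]] lim[unfolded mult_zero_right]])
    thus ?thesis using False by (simp add: b_def)
  qed (use f0 in \<open>simp add: b_def\<close>)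
  hence "(\<lambda>m. suminf (f m)) \<longlonglongrightarrow> suminf b"
    using tannerys_theorem[where a = "\<lambda>n m. f m n" and M = "\<lambda>n. C * r ^ n" and b = b
        and F = sequentially, OF _ _ sM] M
    by (simp add: case_prod_unfold)
  moreover have "suminf b = 1"
    using sums_single[of 0 "\<lambda>_. 1::complex"] by (simp add: b_def sums_iff)
  ultimately show "(\<lambda>m. suminf (f m)) \<longlonglongrightarrow> 1" by simp
qed

section \<open>The Rogers--Ramanujan recurrence\<close>

text \<open>
  This is the functional equation \<open>F(x) = F(x q) + x q F(x q\<^sup>2)\<close> of the Rogers--Ramanujan series
  \<open>F(x) = \<Sum>n. q\<^bsup>n\<^sup>2\<^esup> x\<^sup>n / (q; q)\<^sub>n\<close>, restricted to the points \<open>x = q\<^sup>m\<close>.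
\<close>

definition rr_recurrence :: "complex \<Rightarrow> (nat \<Rightarrow> complex) \<Rightarrow> bool" where
  "rr_recurrence q f \<longleftrightarrow> (\<forall>m. f m = f (m + 1) + q ^ (m + 1) * f (m + 2))"

text \<open>
  Going down from \<open>m + 1\<close> to \<open>m\<close>, the larger of two neighbouring absolute values grows at most by
  the factor \<open>1 + \<bar>q\<bar>\<^bsup>m + 1\<^esup>\<close>. The product of all these factors converges, so a solution that is
  small at infinity is small everywhere.
\<close>

lemma rr_recurrence_limit_0:
  assumes q: "norm q < 1" and rec: "rr_recurrence q f" and lim: "f \<longlonglongrightarrow> 0"
  shows "f m = 0"
proof -
  define M where "M = (\<lambda>m. max (norm (f m)) (norm (f (Suc m))))"
  define P where "P = (\<lambda>m. \<Prod>k<m. 1 + norm q ^ Suc k)"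
  have Ppos: "P m > 0" for m
    unfolding P_def by (intro prod_pos) (auto intro: add_pos_nonneg)
  have step: "M m \<le> (1 + norm q ^ Suc m) * M (Suc m)" for m
  proof -
    have "norm (f m) \<le> norm (f (Suc m)) + norm q ^ Suc m * norm (f (Suc (Suc m)))"
      using rec norm_triangle_ineq[of "f (Suc m)" "q ^ Suc m * f (Suc (Suc m))"]
      unfolding rr_recurrence_def by (metis Suc_eq_plus1 add_2_eq_Suc' norm_mult norm_power)
    also have "\<dots> \<le> M (Suc m) + norm q ^ Suc m * M (Suc m)"
      unfolding M_def by (intro add_mono mult_left_mono) auto
    finally have 1: "norm (f m) \<le> (1 + norm q ^ Suc m) * M (Suc m)" by (simp add: algebra_simps)
    have "norm (f (Suc m)) \<le> 1 * M (Suc m)" by (simp add: M_def)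
    also have "\<dots> \<le> (1 + norm q ^ Suc m) * M (Suc m)"
      by (intro mult_right_mono) (auto simp: M_def le_max_iff_disj)
    finally show ?thesis using 1 unfolding M_def[of] by auto
  qed
  have inc: "incseq (\<lambda>m. P m * M m)"
  proof (rule incseq_SucI)
    fix m
    have "P m * M m \<le> P m * ((1 + norm q ^ Suc m) * M (Suc m))"
      using step Ppos by (intro mult_left_mono) (auto intro: less_imp_le)
    thus "P m * M m \<le> P (Suc m) * M (Suc m)" by (simp add: P_def mult_ac)
  qed
  have "summable (\<lambda>k. \<bar>norm q ^ Suc k\<bar>)"
    using q by (subst abs_of_nonneg) (auto simp del: power_Suc simp: summable_Suc_iff intro: summable_geometric)
  moreover have "norm q ^ Suc k \<noteq> -1" for k
    by (smt (verit) norm_ge_zero zero_le_power)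
  ultimately have "convergent_prod (\<lambda>k. 1 + norm q ^ Suc k)"
    by (intro summable_imp_convergent_prod_real)
  from convergent_prod_LIMSEQ[OF this]
  obtain L where "(\<lambda>m. P (Suc m)) \<longlonglongrightarrow> L"
    by (auto simp: P_def lessThan_Suc_atMost)
  hence "P \<longlonglongrightarrow> L" by (rule LIMSEQ_imp_Suc)
  moreover have "M \<longlonglongrightarrow> max (norm (0::complex)) (norm (0::complex))"
    unfolding M_def by (intro tendsto_max tendsto_norm lim LIMSEQ_Suc)
  ultimately have "(\<lambda>m. P m * M m) \<longlonglongrightarrow> L * 0"
    by (intro tendsto_mult) auto
  from incseq_le[OF inc this] have "P m * M m \<le> 0" by simp
  hence "M m \<le> 0" using Ppos[of m] by (simp add: mult_le_0_iff)
  thus "f m = 0" by (simp add: M_def)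
qed

lemma rr_recurrence_eqI_limit:
  assumes q: "norm q < 1" and f: "rr_recurrence q f" "f \<longlonglongrightarrow> l" and g: "rr_recurrence q g" "g \<longlonglongrightarrow> l"
  shows "f m = g m"
proof -
  have "rr_recurrence q (\<lambda>m. f m - g m)"
    unfolding rr_recurrence_def
  proof
    fix m
    show "f m - g m = f (m + 1) - g (m + 1) + q ^ (m + 1) * (f (m + 2) - g (m + 2))"
      using f(1)[unfolded rr_recurrence_def, rule_format, of m]
        g(1)[unfolded rr_recurrence_def, rule_format, of m]
      by (simp add: algebra_simps)
  qed
  moreover have "(\<lambda>m. f m - g m) \<longlonglongrightarrow> 0"
    using tendsto_diff[OF f(2) g(2)] by simp
  ultimately show ?thesis
    using rr_recurrence_limit_0[OF q, of "\<lambda>m. f m - g m" m] by simp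
qed

text \<open>
  For \<open>q \<noteq> 0\<close> the recurrence can also be run upwards.
\<close>

lemma rr_recurrence_eqI_initial:
  assumes q: "q \<noteq> 0" and f: "rr_recurrence q f" and g: "rr_recurrence q g"
    and "f 0 = g 0" "f 1 = g 1"
  shows "f m = g m"
proof (induction m rule: less_induct)
  case (less m)
  consider "m = 0" | "m = 1" | k where "m = k + 2"
    by (metis One_nat_def add_2_eq_Suc' not0_implies_Suc)
  thus ?case
  proof cases
    case 3
    have "f k = g k" "f (k + 1) = g (k + 1)" using less 3 by auto
    moreover have "f k = f (k + 1) + q ^ (k + 1) * f (k + 2)"
      "g k = g (k + 1) + q ^ (k + 1) * g (k + 2)"
      using f g unfolding rr_recurrence_def by blast+
    ultimately show ?thesis using q 3 by simp
  qed (use assms in auto)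
qed

text \<open>
  All functional equations below hold for this reason: the defects of the individual terms do not
  vanish, but their series telescopes to 0.
\<close>

lemma suminf_telescoping:
  fixes f g h d :: "nat \<Rightarrow> complex"
  assumes "summable f" "summable g" "summable h"
    and "\<And>n. f n - g n - c * h n = d n - d (Suc n)" and "d 0 = 0" "d \<longlonglongrightarrow> 0"
  shows "suminf f = suminf g + c * suminf h"
proof -
  have "(\<lambda>n. f n - g n - c * h n) sums (suminf f - suminf g - c * suminf h)"
    by (intro sums_diff sums_mult summable_sums assms)
  moreover have "(\<lambda>n. d n - d (Suc n)) sums (d 0 - 0)"
    using assms by (intro telescope_sums')
  ultimately have "suminf f - suminf g - c * suminf h = 0"
    using assms by (auto dest: sums_unique2)
  thus ?thesis by (simp add: algebra_simps)
qed

section \<open>Jacobi's triple product\<close>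

text \<open>
  With \<open>z w = p\<close>, expand \<open>(z; p)\<^sub>n (w; p)\<^sub>n\<close> in powers of \<open>z\<close> and \<open>w\<close>. The coefficients are,
  up to sign and a power of \<open>p\<close>, central Gaussian binomials \<open>2n\<close> over \<open>n + k\<close>; the infinite
  product follows for \<open>n \<rightarrow> \<infinity>\<close>. Writing \<open>w\<^sup>k\<close> for what is usually \<open>p\<^sup>k z\<^bsup>-k\<^esup>\<close>
  avoids negative exponents and makes the identity symmetric in \<open>z\<close> and \<open>w\<close>.
\<close>

lemma Suc_choose_2: "Suc k choose 2 = (k choose 2) + k"
  by (simp add: numeral_2_eq_2)

text \<open>
  The Gaussian binomial \<open>2n\<close> over \<open>n + k\<close>, divided by \<open>(p; p)\<^bsub>2n\<^esub>\<close>.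
\<close>

definition sym_coeff :: "complex \<Rightarrow> nat \<Rightarrow> nat \<Rightarrow> complex" where
  "sym_coeff p n k = (if k \<le> n then 1 / (qpoch p p (n - k) * qpoch p p (n + k)) else 0)"

definition jtp_coeff :: "complex \<Rightarrow> nat \<Rightarrow> nat \<Rightarrow> complex" where
  "jtp_coeff p n k = (-1) ^ k * p ^ (k choose 2) * sym_coeff p n k"

lemma jtp_coeff_eq_0: "k > n \<Longrightarrow> jtp_coeff p n k = 0"
  by (simp add: jtp_coeff_def sym_coeff_def)

text \<open>
  The factor \<open>(1 - z p\<^sup>n) (1 - w p\<^sup>n) = 1 + p\<^bsup>2n + 1\<^esup> - p\<^sup>n z - p\<^sup>n w\<close> leading from \<open>n\<close> to \<open>n + 1\<close>
  forces the next two recurrences. At \<open>k = 0\<close> both neighbours are the same coefficient, whence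
  the factor 2. In both proofs everything is expressed by the one coefficient \<open>D\<close> at \<open>n + 1\<close>,
  which leaves a polynomial identity.
\<close>

lemma jtp_coeff_Suc_0:
  assumes p: "norm p < 1"
  shows "(1 - p ^ (2*n+1)) * (1 - p ^ (2*n+2)) * jtp_coeff p (Suc n) 0
     = (1 + p ^ (2*n+1)) * jtp_coeff p n 0 - 2 * p ^ (n + 1) * jtp_coeff p n 1"
proof -
  have nz: "1 - p ^ Suc j \<noteq> 0" for j
    using qpoch_factor_nonzero[OF p p, of j] by simp
  define R where "R = (\<lambda>j. 1 / qpoch p p j)"
  have S: "R j = (1 - p ^ Suc j) * R (Suc j)" for j
    using nz[of j] qpoch_nonzero[OF p p, of j] by (simp add: qpoch_Suc R_def)
  have D: "sym_coeff p n k = R (n - k) * R (n + k)" if "k \<le> n" for n k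
    using that by (simp add: sym_coeff_def R_def)
  define D where "D = sym_coeff p (Suc n) 0"
  define y where "y = p ^ n"
  have D0: "sym_coeff p n 0 = (1 - p * y) * (1 - p * y) * D"
    using S[of n] by (simp add: D D_def y_def)
  have D1: "p * sym_coeff p n 1 = (1 - p * y) * (p - p * y) * D"
  proof (cases n)
    case (Suc j)
    have "sym_coeff p n 1 = R j * R (Suc (Suc j))"
      by (simp add: D Suc)
    also have "R j = (1 - p ^ Suc j) * (1 - p ^ Suc (Suc j)) * R (Suc (Suc j))"
      using S[of j] S[of "Suc j"] by simp
    finally have e: "sym_coeff p n 1 = (1 - p * y) * (1 - y) * D"
      by (simp add: D D_def y_def Suc mult_ac)
    show ?thesis unfolding e by (simp add: algebra_simps)
  qed (simp add: sym_coeff_def y_def)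
  have y2: "p ^ (2*n+1) = p * y * y" "p ^ (2*n+2) = p * p * y * y" "p ^ (n + 1) = p * y"
    by (simp_all add: y_def power_add mult_2)
  have "(1 - p*y*y) * (1 - p*p*y*y) * D = (1 + p*y*y) * ((1 - p * y) * (1 - p * y) * D)
     + 2 * y * ((1 - p * y) * (p - p * y) * D)"
    by (simp add: algebra_simps)
  note main = this
  have J: "jtp_coeff p n 0 = sym_coeff p n 0" "jtp_coeff p (Suc n) 0 = D"
    "2 * (p * y) * jtp_coeff p n 1 = - (2 * y * (p * sym_coeff p n 1))"
    by (simp_all add: jtp_coeff_def D_def numeral_2_eq_2)
  show ?thesis
    unfolding y2 J D0 D1 main by (simp only: diff_minus_eq_add)
qed

lemma jtp_coeff_Suc_Suc:
  assumes p: "norm p < 1"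
  shows "(1 - p ^ (2*n+1)) * (1 - p ^ (2*n+2)) * jtp_coeff p (Suc n) (Suc k)
     = (1 + p ^ (2*n+1)) * jtp_coeff p n (Suc k) - p ^ n * jtp_coeff p n k
       - p ^ (n + 1) * jtp_coeff p n (Suc (Suc k))"
proof (cases "k \<le> n")
  case False
  thus ?thesis by (simp add: jtp_coeff_eq_0)
next
  case True
  then obtain d where n: "n = k + d" using le_Suc_ex by blast
  have nz: "1 - p ^ Suc j \<noteq> 0" for j
    using qpoch_factor_nonzero[OF p p, of j] by simp
  define R where "R = (\<lambda>j. 1 / qpoch p p j)"
  have S: "R j = (1 - p ^ Suc j) * R (Suc j)" for j
    using nz[of j] qpoch_nonzero[OF p p, of j] by (simp add: qpoch_Suc R_def)
  have D: "sym_coeff p n k = R (n - k) * R (n + k)" if "k \<le> n" for n k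
    using that by (simp add: sym_coeff_def R_def)
  define c where "c = (-1) ^ k * p ^ (k choose 2)"
  define D where "D = sym_coeff p (Suc n) (Suc k)"
  define x where "x = p ^ k"
  define y where "y = p ^ d"
  have J: "jtp_coeff p n k = c * sym_coeff p n k"
    "jtp_coeff p n (Suc k) = - (x * c) * sym_coeff p n (Suc k)"
    "jtp_coeff p (Suc n) (Suc k) = - (x * c) * D"
    "jtp_coeff p n (Suc (Suc k)) = x * x * c * (p * sym_coeff p n (Suc (Suc k)))"
    unfolding jtp_coeff_def c_def D_def x_def Suc_choose_2 power_add power_Suc
    by (simp_all add: mult_ac)
  have e: "Suc n + Suc k = Suc (Suc (2 * k + d))" "Suc n - Suc k = d" "n + k = 2 * k + d" "n - k = d"
    "n + Suc k = Suc (2 * k + d)" "n + Suc (Suc k) = Suc (Suc (2 * k + d))"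
    using n by simp_all
  have xy: "p ^ Suc (2 * k + d) = p * x * x * y" "p ^ Suc (Suc (2 * k + d)) = p * p * x * x * y"
    by (simp_all add: x_def y_def power_add mult_2 mult_2_right mult_ac)
  have D': "D = R d * R (Suc (Suc (2 * k + d)))"
    using True by (simp only: D_def D Suc_le_mono e)
  have S2: "R (Suc (2 * k + d)) = (1 - p * p * x * x * y) * R (Suc (Suc (2 * k + d)))"
    using S[of "Suc (2 * k + d)"] by (simp only: xy)
  have S1: "R (2 * k + d) = (1 - p * x * x * y) * R (Suc (2 * k + d))"
    using S[of "2 * k + d"] by (simp only: xy)
  have D0: "sym_coeff p n k = (1 - p * x * x * y) * (1 - p * p * x * x * y) * D"
    unfolding D[OF True] e S1 S2 D' by simp
  have D1: "sym_coeff p n (Suc k) = (1 - y) * (1 - p * p * x * x * y) * D"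
  proof (cases d)
    case (Suc j)
    have "sym_coeff p n (Suc k) = R j * R (Suc (2 * k + d))"
      using n Suc D[of "Suc k" n] unfolding e by simp
    also have "R j = (1 - y) * R d"
      using S[of j] by (simp only: y_def Suc)
    finally show ?thesis by (simp add: S2 D')
  qed (simp add: sym_coeff_def n y_def)
  have D2: "p * sym_coeff p n (Suc (Suc k)) = (1 - y) * (p - y) * D"
  proof -
    consider "d = 0" | "d = 1" | j where "d = Suc (Suc j)"
      by (metis One_nat_def not0_implies_Suc)
    thus ?thesis
    proof cases
      case 3
      have "sym_coeff p n (Suc (Suc k)) = R j * R (Suc (Suc (2 * k + d)))"
        using n 3 D[of "Suc (Suc k)" n] unfolding e by simp
      also have "R j = (1 - p ^ Suc j) * (1 - p ^ Suc (Suc j)) * R d"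
        using S[of j] S[of "Suc j"] 3 by simp
      finally have e: "sym_coeff p n (Suc (Suc k)) = (1 - p ^ Suc j) * (1 - y) * D"
        by (simp add: D' y_def 3 mult_ac)
      show ?thesis unfolding e by (simp add: y_def 3 algebra_simps)
    qed (simp_all add: sym_coeff_def n y_def)
  qed
  have y2: "p ^ (2*n+1) = p * x * x * y * y" "p ^ (2*n+2) = p * p * x * x * y * y"
    "p ^ (n + 1) = p * x * y" "p ^ n = x * y"
    by (simp_all add: y_def x_def n power_add mult_2 mult_2_right mult_ac)
  show ?thesis
    unfolding y2 J D0 D1 D2 by (simp add: algebra_simps)
qed

text \<open>
  The constant term occurs in both sums and is therefore subtracted once.
\<close>

lemma finite_triple_product:
  assumes p: "norm p < 1" and zw: "z * w = p"
  shows "qpoch z p n * qpoch w p n / qpoch p p (2 * n)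
    = (\<Sum>k\<le>n. jtp_coeff p n k * z ^ k) + (\<Sum>k\<le>n. jtp_coeff p n k * w ^ k) - jtp_coeff p n 0"
proof (induction n)
  case 0
  show ?case by (simp add: jtp_coeff_def sym_coeff_def numeral_2_eq_2)
next
  case (Suc n)
  define \<kappa> where "\<kappa> = (1 - p ^ (2*n+1)) * (1 - p ^ (2*n+2))"
  define E where "E = jtp_coeff p n"
  define E' where "E' = jtp_coeff p (Suc n)"
  define F where "F = (\<lambda>t. \<Sum>k\<le>n. E k * t ^ k)"
  have E0: "E k = 0" if "k > n" for k using that by (simp add: E_def jtp_coeff_eq_0)
  have \<kappa>: "\<kappa> \<noteq> 0"
    using qpoch_factor_nonzero[OF p p, of "2*n"] qpoch_factor_nonzero[OF p p, of "2*n+1"]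
    by (simp add: \<kappa>_def)
  \<comment> \<open>Shifting the index up costs a factor \<open>t\<close>, shifting it down a factor \<open>u = p / t\<close>. The last two
      terms come from the ends of these shifts; added up for both orders of \<open>z\<close> and \<open>w\<close>, they make up
      what the doubly counted constant term requires.\<close>
  have key: "\<kappa> * (\<Sum>k\<le>Suc n. E' k * t ^ k) = (1 + p ^ (2*n+1) - p ^ n * t - p ^ n * u) * F t
      + p ^ n * u * E 0 - p ^ (n + 1) * E 1" if tu: "t * u = p" for t u
  proof -
    have F: "F t = (\<Sum>k\<le>N. E k * t ^ k)" if "N \<ge> n" for N
      unfolding F_def using that by (intro sum.mono_neutral_left) (auto simp: E0)
    have F1: "(\<Sum>k\<le>n. E (Suc k) * t ^ Suc k) = F t - E 0"
      using F[of "Suc n"] by (simp only: sum.atMost_Suc_shift) simp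
    have F2: "(\<Sum>k\<le>n. E (Suc (Suc k)) * t ^ Suc (Suc k)) = F t - E 0 - E 1 * t"
      using F[of "Suc (Suc n)"] by (simp only: sum.atMost_Suc_shift) simp
    have "\<kappa> * (\<Sum>k\<le>Suc n. E' k * t ^ k) = \<kappa> * E' 0 + (\<Sum>k\<le>n. (\<kappa> * E' (Suc k)) * t ^ Suc k)"
      by (simp only: sum.atMost_Suc_shift) (simp add: sum_distrib_left algebra_simps)
    also have "(\<Sum>k\<le>n. (\<kappa> * E' (Suc k)) * t ^ Suc k) =
       (\<Sum>k\<le>n. (1 + p ^ (2*n+1)) * (E (Suc k) * t ^ Suc k) - p ^ n * t * (E k * t ^ k)
          - p ^ n * u * (E (Suc (Suc k)) * t ^ Suc (Suc k)))"
    proof (intro sum.cong refl)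
      fix k
      have e: "\<kappa> * E' (Suc k) = (1 + p ^ (2*n+1)) * E (Suc k) - p ^ n * E k - p ^ n * p * E (Suc (Suc k))"
        using jtp_coeff_Suc_Suc[OF p, of n k] by (simp add: \<kappa>_def E_def E'_def mult_ac)
      show "(\<kappa> * E' (Suc k)) * t ^ Suc k = (1 + p ^ (2*n+1)) * (E (Suc k) * t ^ Suc k) - p ^ n * t * (E k * t ^ k)
          - p ^ n * u * (E (Suc (Suc k)) * t ^ Suc (Suc k))"
        unfolding e power_Suc tu [symmetric] by (simp only: ring_distribs mult_ac)
    qed
    also have "\<dots> = (1 + p ^ (2*n+1)) * (F t - E 0) - p ^ n * t * F t - p ^ n * u * (F t - E 0 - E 1 * t)"
      unfolding sum_subtractf sum_distrib_left [symmetric] F1 F2 by (simp only: F_def)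
    also have "\<kappa> * E' 0 = (1 + p ^ (2*n+1)) * E 0 - 2 * p ^ (n + 1) * E 1"
      using jtp_coeff_Suc_0[OF p, of n] by (simp add: \<kappa>_def E_def E'_def)
    finally have e: "\<kappa> * (\<Sum>k\<le>Suc n. E' k * t ^ k) = (1 + p ^ (2*n+1)) * E 0 - 2 * p ^ (n + 1) * E 1 +
       ((1 + p ^ (2*n+1)) * (F t - E 0) - p ^ n * t * F t - p ^ n * u * (F t - E 0 - E 1 * t))" .
    have "p ^ n * u * (E 1 * t) = p ^ (n + 1) * E 1" using tu by (simp add: mult_ac)
    with e show ?thesis by (simp only: ring_distribs) (simp add: algebra_simps)
  qed
  have "qpoch z p (Suc n) * qpoch w p (Suc n) / qpoch p p (2 * Suc n)
     = qpoch z p n * qpoch w p n / qpoch p p (2 * n) * ((1 - z * p ^ n) * (1 - w * p ^ n)) / \<kappa>"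
    by (simp add: qpoch_Suc \<kappa>_def mult_ac)
  also have "(1 - z * p ^ n) * (1 - w * p ^ n) = 1 + p ^ (2*n+1) - p ^ n * z - p ^ n * w"
    by (simp add: algebra_simps zw [symmetric] power_mult_distrib mult_2 mult_2_right power_add)
  also have "qpoch z p n * qpoch w p n / qpoch p p (2 * n) = F z + F w - E 0"
    using Suc.IH by (simp add: F_def E_def)
  also have "(F z + F w - E 0) * (1 + p ^ (2*n+1) - p ^ n * z - p ^ n * w)
     = \<kappa> * ((\<Sum>k\<le>Suc n. E' k * z ^ k) + (\<Sum>k\<le>Suc n. E' k * w ^ k) - E' 0)"
  proof -
    have "\<kappa> * E' 0 = (1 + p ^ (2*n+1)) * E 0 - 2 * p ^ (n + 1) * E 1"
      using jtp_coeff_Suc_0[OF p, of n] by (simp add: \<kappa>_def E_def E'_def)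
    moreover have "w * z = p" using zw by (simp add: mult.commute)
    ultimately show ?thesis
      using key[OF zw] key[of w z] by (simp add: ring_distribs)
  qed
  finally show ?case using \<kappa> by (simp add: E'_def)
qed

lemma summable_theta:
  fixes p z :: complex
  assumes p: "norm p < 1"
  shows "summable (\<lambda>k. norm p ^ (k choose 2) * norm z ^ k)"
proof -
  have "(\<lambda>k. norm p ^ k * norm z) \<longlonglongrightarrow> 0 * norm z"
    using p by (intro tendsto_mult tendsto_const LIMSEQ_realpow_zero) auto
  hence "eventually (\<lambda>k. norm p ^ k * norm z < 1/2) sequentially"
    by (rule order_tendstoD) simp
  then obtain N where N: "\<And>k. k \<ge> N \<Longrightarrow> norm p ^ k * norm z < 1/2"
    by (auto simp: eventually_sequentially)
  show ?thesis
  proof (rule summable_ratio_test[of "1/2" N])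
    fix k assume "k \<ge> N"
    have "norm p ^ (k choose 2) * norm z ^ k * (norm p ^ k * norm z)
       \<le> norm p ^ (k choose 2) * norm z ^ k * (1/2)"
      using N[OF \<open>k \<ge> N\<close>] by (intro mult_left_mono) auto
    thus "norm (norm p ^ (Suc k choose 2) * norm z ^ Suc k)
       \<le> 1/2 * norm (norm p ^ (k choose 2) * norm z ^ k)"
      by (simp add: Suc_choose_2 power_add norm_mult norm_power mult_ac)
  qed simp
qed

text \<open>
  Tannery's theorem again: the factors \<open>sym_coeff p n k\<close> are bounded and, for \<open>n \<rightarrow> \<infinity>\<close>, tend to \<open>1 / (p; p)\<^sub>\<infinity>\<^sup>2\<close>.
\<close>

lemma jtp_sum_tendsto:
  assumes p: "norm p < 1"
  shows "summable (\<lambda>k. (-1) ^ k * p ^ (k choose 2) * z ^ k)"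
    and "(\<lambda>n. \<Sum>k\<le>n. jtp_coeff p n k * z ^ k)
       \<longlonglongrightarrow> (\<Sum>k. (-1) ^ k * p ^ (k choose 2) * z ^ k) / (qpoch_inf p p)\<^sup>2"
    and "(\<lambda>n. jtp_coeff p n 0) \<longlonglongrightarrow> 1 / (qpoch_inf p p)\<^sup>2"
proof -
  have nz: "qpoch_inf p p \<noteq> 0" using qpoch_inf_nonzero[OF p p] .
  obtain C where C: "C > 0" "\<And>n. norm (1 / qpoch p p n) \<le> C"
    using inverse_qpoch_bounded[OF p p] by blast
  define c where "c = (\<lambda>k. (-1) ^ k * p ^ (k choose 2) * z ^ k)"
  have normc: "norm (c k) = norm p ^ (k choose 2) * norm z ^ k" for k
    by (simp add: c_def norm_mult norm_power)
  show sc: "summable (\<lambda>k. (-1) ^ k * p ^ (k choose 2) * z ^ k)"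
    unfolding c_def [symmetric]
    by (rule summable_norm_cancel) (use summable_theta[OF p, of z] normc in simp)
  have lim: "(\<lambda>n. sym_coeff p n k) \<longlonglongrightarrow> 1 / (qpoch_inf p p)\<^sup>2" for k
  proof -
    have "(\<lambda>n. 1 / (qpoch p p n * qpoch p p (n + 2 * k))) \<longlonglongrightarrow> 1 / (qpoch_inf p p * qpoch_inf p p)"
      by (intro tendsto_intros LIMSEQ_ignore_initial_segment qpoch_tendsto p) (use nz in auto)
    also have "(\<lambda>n. 1 / (qpoch p p n * qpoch p p (n + 2 * k))) = (\<lambda>n. sym_coeff p (n + k) k)"
      by (auto simp: sym_coeff_def mult_2 add_ac)
    finally show ?thesis
      unfolding power2_eq_square by (rule LIMSEQ_offset)
  qed
  show "(\<lambda>n. jtp_coeff p n 0) \<longlonglongrightarrow> 1 / (qpoch_inf p p)\<^sup>2"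
    using lim[of 0] by (simp add: jtp_coeff_def numeral_2_eq_2)
  have fin: "(\<Sum>k\<le>n. jtp_coeff p n k * z ^ k) = (\<Sum>k. c k * sym_coeff p n k)" for n
    by (subst suminf_finite[of "{..n}"])
       (auto simp: c_def jtp_coeff_def sym_coeff_def intro!: sum.cong)
  have bnd: "norm (c k * sym_coeff p n k) \<le> C * C * norm (c k)" for n k
  proof -
    have "norm (sym_coeff p n k) \<le> C * C"
    proof (cases "k \<le> n")
      case True
      have "norm (1 / qpoch p p (n - k)) * norm (1 / qpoch p p (n + k)) \<le> C * C"
        using C by (intro mult_mono) (auto intro: less_imp_le)
      thus ?thesis using True by (simp add: sym_coeff_def norm_mult norm_divide)
    qed (use C in \<open>simp add: sym_coeff_def\<close>)
    from mult_right_mono[OF this norm_ge_zero[of "c k"]] show ?thesis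
      by (simp add: norm_mult mult_ac)
  qed
  have "(\<lambda>n. \<Sum>k. c k * sym_coeff p n k) \<longlonglongrightarrow> (\<Sum>k. c k * (1 / (qpoch_inf p p)\<^sup>2))"
  proof -
    have l: "(\<lambda>n. c k * sym_coeff p n k) \<longlonglongrightarrow> c k * (1 / (qpoch_inf p p)\<^sup>2)" for k
      by (intro tendsto_intros lim)
    have s: "summable (\<lambda>k. C * C * norm (c k))"
      using summable_theta[OF p, of z] by (intro summable_mult) (simp add: normc)
    show ?thesis
      using tannerys_theorem[where F = sequentially, OF l _ s] bnd
      by (simp add: case_prod_unfold)
  qed
  also have "(\<Sum>k. c k * (1 / (qpoch_inf p p)\<^sup>2)) = (\<Sum>k. c k) / (qpoch_inf p p)\<^sup>2"
    using suminf_divide[OF sc] by (simp add: c_def)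
  finally show "(\<lambda>n. \<Sum>k\<le>n. jtp_coeff p n k * z ^ k)
       \<longlonglongrightarrow> (\<Sum>k. (-1) ^ k * p ^ (k choose 2) * z ^ k) / (qpoch_inf p p)\<^sup>2"
    unfolding fin by (simp add: c_def)
qed

text \<open>
  The bilateral theta series is folded at its centre: the term with index \<open>- (k + 1)\<close> is paired
  with the term with index \<open>k\<close>.
\<close>

theorem jacobi_triple_product:
  assumes p: "norm p < 1" and zw: "z * w = p"
  shows "(\<lambda>k. (-1) ^ k * (p ^ (k choose 2) * z ^ k - p ^ (Suc k choose 2) * w ^ Suc k))
     sums (qpoch_inf z p * qpoch_inf w p * qpoch_inf p p)"
proof -
  define \<theta> where "\<theta> = (\<lambda>t k. (-1) ^ k * p ^ (k choose 2) * t ^ k)"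
  have nz: "qpoch_inf p p \<noteq> 0" using qpoch_inf_nonzero[OF p p] .
  have s: "summable (\<theta> t)" for t unfolding \<theta>_def by (rule jtp_sum_tendsto[OF p])
  have "strict_mono (\<lambda>n. 2 * n :: nat)" by (simp add: strict_mono_def)
  hence "(\<lambda>n. qpoch p p (2 * n)) \<longlonglongrightarrow> qpoch_inf p p"
    using LIMSEQ_subseq_LIMSEQ[OF qpoch_tendsto[OF p]] by (force simp: o_def)
  hence "(\<lambda>n. qpoch z p n * qpoch w p n / qpoch p p (2 * n))
     \<longlonglongrightarrow> qpoch_inf z p * qpoch_inf w p / qpoch_inf p p"
    by (intro tendsto_intros qpoch_tendsto p nz)
  moreover have "(\<lambda>n. qpoch z p n * qpoch w p n / qpoch p p (2 * n)) \<longlonglongrightarrow>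
     suminf (\<theta> z) / (qpoch_inf p p)\<^sup>2 + suminf (\<theta> w) / (qpoch_inf p p)\<^sup>2 - 1 / (qpoch_inf p p)\<^sup>2"
    unfolding finite_triple_product[OF p zw] \<theta>_def
    by (intro tendsto_intros jtp_sum_tendsto p)
  ultimately have "qpoch_inf z p * qpoch_inf w p / qpoch_inf p p =
     suminf (\<theta> z) / (qpoch_inf p p)\<^sup>2 + suminf (\<theta> w) / (qpoch_inf p p)\<^sup>2 - 1 / (qpoch_inf p p)\<^sup>2"
    by (rule LIMSEQ_unique)
  hence "qpoch_inf z p * qpoch_inf w p / qpoch_inf p p * (qpoch_inf p p)\<^sup>2 =
     suminf (\<theta> z) + (suminf (\<theta> w) - 1)"
    using nz by (simp add: add_divide_distrib [symmetric] diff_divide_distrib [symmetric])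
  hence "qpoch_inf z p * qpoch_inf w p * qpoch_inf p p = suminf (\<theta> z) + (suminf (\<theta> w) - 1)"
    using nz by (simp add: power2_eq_square mult.assoc)
  also have "suminf (\<theta> w) - 1 = (\<Sum>k. \<theta> w (Suc k))"
    using suminf_split_head[OF s[of w]] by (simp add: \<theta>_def numeral_2_eq_2)
  finally have "(\<lambda>k. \<theta> z k + \<theta> w (Suc k)) sums (qpoch_inf z p * qpoch_inf w p * qpoch_inf p p)"
    using s by (auto intro!: sums_add summable_sums simp: summable_Suc_iff)
  thus ?thesis by (simp add: \<theta>_def algebra_simps)
qed

section \<open>The alternating series\<close>

text \<open>
  The summand of the first identity, times \<open>(-q\<^bsup>m + 1\<^esup>; q)\<^sub>\<infinity>\<close>: the factors
  \<open>(-q\<^bsup>m + 1\<^esup>, -q\<^bsup>m + 2\<^esup>; q\<^sup>2)\<^sub>n = (-q\<^bsup>m + 1\<^esup>; q)\<^bsub>2n\<^esub>\<close> in the denominator turn into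
  a tail of this product.
\<close>

definition alternating_term :: "complex \<Rightarrow> nat \<Rightarrow> nat \<Rightarrow> complex" where
  "alternating_term q m n = (-1) ^ n * q ^ (3 * n\<^sup>2 + 2 * m * n) / qpoch (q\<^sup>2) (q\<^sup>2) n
     * qpoch_inf (- (q ^ (m + 2 * n + 1))) q"

lemma alternating_tail:
  assumes "norm q < 1"
  shows "(\<lambda>j. qpoch_inf (- (q ^ (j + 1))) q) \<longlonglongrightarrow> 1"
  using qpoch_inf_shift_tendsto_1[OF assms, of "- q"] assms by simp

lemma alternating_term_bound:
  assumes q: "norm q < 1"
  obtains C where "\<And>m n. norm (alternating_term q m n) \<le> C * norm q ^ ((m + 1) * n)"
proof -
  have q2: "norm (q\<^sup>2) < 1" using q by (simp add: norm_power power_less_one_iff)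
  obtain A where A: "A > 0" "\<And>n. norm (1 / qpoch (q\<^sup>2) (q\<^sup>2) n) \<le> A"
    using inverse_qpoch_bounded[OF q2 q2] by blast
  obtain B where B: "B > 0" "\<And>j. norm (qpoch_inf (- (q ^ (j + 1))) q) \<le> B"
    using convergent_norm_bounded[OF alternating_tail[OF q]] by blast
  show ?thesis
  proof (rule that)
    fix m n :: nat
    have "n * 1 \<le> n * n" by (cases n) simp_all
    hence E: "(m + 1) * n \<le> 3 * n\<^sup>2 + 2 * m * n"
      unfolding power2_eq_square distrib_right by linarith
    have "norm (alternating_term q m n) = norm q ^ (3 * n\<^sup>2 + 2 * m * n)
        * (norm (1 / qpoch (q\<^sup>2) (q\<^sup>2) n) * norm (qpoch_inf (- (q ^ (m + 2 * n + 1))) q))"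
      by (simp add: alternating_term_def norm_mult norm_divide norm_power)
    also have "\<dots> \<le> norm q ^ ((m + 1) * n) * (A * B)"
      using q A B E by (intro mult_mono power_decreasing) (auto intro: less_imp_le)
    finally show "norm (alternating_term q m n) \<le> (A * B) * norm q ^ ((m + 1) * n)"
      by (simp add: mult_ac)
  qed
qed

lemma summable_alternating_term:
  assumes q: "norm q < 1"
  shows "summable (alternating_term q m)"
proof -
  obtain C where "\<And>m n. norm (alternating_term q m n) \<le> C * norm q ^ ((m + 1) * n)"
    using alternating_term_bound[OF q] by blast
  thus ?thesis using dominated_series_summable[of "norm q" "alternating_term q" C m] q by simp
qed

lemma alternating_sum_tendsto:
  assumes q: "norm q < 1"
  shows "(\<lambda>m. suminf (alternating_term q m)) \<longlonglongrightarrow> 1"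
proof -
  obtain C where "\<And>m n. norm (alternating_term q m n) \<le> C * norm q ^ ((m + 1) * n)"
    using alternating_term_bound[OF q] by blast
  moreover have "(\<lambda>m. alternating_term q m 0) \<longlonglongrightarrow> 1"
    using alternating_tail[OF q] by (simp add: alternating_term_def)
  ultimately show ?thesis using dominated_series_tendsto[of "norm q" "alternating_term q" C] q by simp
qed

text \<open>
  Put \<open>x = q\<^sup>m\<close>, \<open>N = q\<^sup>n\<close>. In terms of the shortest tail \<open>E\<close>, the defect of the recurrence has the
  factor \<open>(1 + x N\<^sup>2 q) (1 + x N\<^sup>2 q\<^sup>2) - N\<^sup>2 (1 + x N\<^sup>2 q\<^sup>2) - x q N\<^sup>4
  = (1 - N\<^sup>2) (1 + x N\<^sup>2 q) (1 + x N\<^sup>2 q\<^sup>2) + x\<^sup>2 N\<^sup>6 q\<^sup>3\<close>; the two summands on the right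
  correspond to \<open>d n\<close> and \<open>- d (n + 1)\<close>.
\<close>

lemma alternating_sum_recurrence:
  assumes q: "norm q < 1"
  shows "rr_recurrence q (\<lambda>m. suminf (alternating_term q m))"
  unfolding rr_recurrence_def
proof
  fix m
  define d where "d = (\<lambda>n. alternating_term q m n * (1 - q ^ (2 * n)))"
  show "suminf (alternating_term q m) = suminf (alternating_term q (m + 1)) + q ^ (m + 1) * suminf (alternating_term q (m + 2))"
  proof (rule suminf_telescoping)
    have "(\<lambda>n. q ^ (2 * n)) \<longlonglongrightarrow> 0"
      unfolding power_mult using q
      by (intro LIMSEQ_power_zero) (simp add: norm_power power_less_one_iff)
    from tendsto_mult[OF summable_LIMSEQ_zero[OF summable_alternating_term[OF q]] tendsto_diff[OF tendsto_const[of 1] this]]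
    show "d \<longlonglongrightarrow> 0" by (simp add: d_def)
    show "d 0 = 0" by (simp add: d_def)
    fix n
    define x where "x = q ^ m"
    define N where "N = q ^ n"
    define E where "E = qpoch_inf (- (q ^ (m + 2 * n + 3))) q"
    define P where "P = qpoch (q\<^sup>2) (q\<^sup>2) n"
    define c where "c = (-1) ^ n * q ^ (3 * n\<^sup>2 + 2 * m * n) / P"
    have E1: "qpoch_inf (- (q ^ (m + 2 * n + 2))) q = (1 + x * N * N * q * q) * E"
      using qpoch_inf_tail_Suc[OF q, of "- (q ^ (m + 2 * n + 2))"]
      by (simp add: E_def x_def N_def power_add mult_2 mult_2_right numeral_3_eq_3 mult_ac)
    have E0: "qpoch_inf (- (q ^ (m + 2 * n + 1))) q = (1 + x * N * N * q) * ((1 + x * N * N * q * q) * E)"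
      unfolding E1 [symmetric]
      using qpoch_inf_tail_Suc[OF q, of "- (q ^ (m + 2 * n + 1))"]
      by (simp add: x_def N_def power_add mult_2 mult_2_right mult_ac)
    have nz: "1 - N * N * q * q \<noteq> 0"
      using power_ne_1_complex[OF q, of "2 * n + 2"] by (simp add: N_def power_add mult_2 mult_2_right mult_ac)
    have Q: "(q\<^sup>2) ^ n = N * N" by (simp add: N_def power2_eq_square power_mult_distrib)
    have t0: "alternating_term q m n = c * ((1 + x * N * N * q) * ((1 + x * N * N * q * q) * E))"
      unfolding alternating_term_def E0 by (simp add: c_def P_def)
    have "alternating_term q (m + 1) n = c * q ^ (2 * n) * qpoch_inf (- (q ^ (m + 2 * n + 2))) q"
      by (simp add: alternating_term_def c_def P_def power_add algebra_simps)
    hence t1: "alternating_term q (m + 1) n = c * (N * N) * ((1 + x * N * N * q * q) * E)"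
      unfolding E1 by (simp add: N_def mult_2 mult_2_right power_add)
    have s: "m + 2 + 2 * n + 1 = m + 2 * n + 3" "3 * n\<^sup>2 + 2 * (m + 2) * n = (3 * n\<^sup>2 + 2 * m * n) + 4 * n"
      by (simp_all add: algebra_simps)
    have "alternating_term q (m + 2) n = c * q ^ (4 * n) * E"
      unfolding alternating_term_def s E_def [symmetric] power_add[of q "3 * n\<^sup>2 + 2 * m * n"] by (simp add: c_def P_def)
    moreover have "q ^ (4 * n) = N * N * N * N"
    proof -
      have e: "4 * n = n + n + n + n" by simp
      show ?thesis unfolding e power_add N_def by simp
    qed
    ultimately have t2: "alternating_term q (m + 2) n = c * (N * N * N * N) * E"
      by simp
    have ex: "3 * (Suc n)\<^sup>2 + 2 * m * Suc n = (3 * n\<^sup>2 + 2 * m * n) + (6 * n + 3 + 2 * m)"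
      by (simp add: power2_eq_square algebra_simps)
    have pw: "q ^ (6 * n + 3 + 2 * m) = N * N * N * N * N * N * q * q * q * x * x"
    proof -
      have e: "6 * n + 3 + 2 * m = n + n + n + n + n + n + 1 + 1 + 1 + m + m" by simp
      show ?thesis unfolding e power_add N_def x_def by simp
    qed
    have "alternating_term q m (Suc n) * (1 - N * N * q * q)
        = - (c * (N * N * N * N * N * N * q * q * q * x * x) * E)"
    proof -
      have Ps: "qpoch (q\<^sup>2) (q\<^sup>2) (Suc n) = P * (1 - N * N * q * q)"
        unfolding qpoch_Suc P_def Q by (simp add: power2_eq_square mult_ac)
      have E2: "qpoch_inf (- (q ^ (m + 2 * Suc n + 1))) q = E"
        by (simp add: E_def numeral_3_eq_3)
      show ?thesis
        unfolding alternating_term_def ex power_add[of q "3 * n\<^sup>2 + 2 * m * n"] pw Ps E2 c_def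
        using nz by (simp add: mult_ac)
    qed
    note t3 = this
    have pws: "q ^ (2 * Suc n) = N * N * q * q" "q ^ (2 * n) = N * N" "q ^ (m + 1) = x * q"
      by (simp_all add: N_def x_def mult_2 mult_2_right power_add mult_ac)
    show "alternating_term q m n - alternating_term q (m + 1) n - q ^ (m + 1) * alternating_term q (m + 2) n
       = d n - d (Suc n)"
      unfolding d_def pws t1 t2 t3 t0 by (simp add: algebra_simps)
  qed (intro summable_alternating_term q)+
qed

section \<open>The series with pentagonal exponents\<close>

text \<open>
  The summand of the second identity, times \<open>(q\<^bsup>2m + 1\<^esup>; q\<^sup>2)\<^sub>\<infinity>\<close>. It solves the recurrence
  with \<open>q\<^sup>2\<close> in place of \<open>q\<close>.
\<close>

definition pentagonal_term :: "complex \<Rightarrow> nat \<Rightarrow> nat \<Rightarrow> complex" where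
  "pentagonal_term q m n = q ^ ((3 * n\<^sup>2 - n) div 2 + 2 * m * n) / qpoch q q n
     * qpoch_inf (q ^ (2 * (m + n) + 1)) (q\<^sup>2)"

lemma pentagonal_tail:
  assumes "norm q < 1"
  shows "(\<lambda>j. qpoch_inf (q ^ (2 * j + 1)) (q\<^sup>2)) \<longlonglongrightarrow> 1"
  using qpoch_inf_shift_tendsto_1[of "q\<^sup>2" q] assms
  by (simp add: norm_power power_less_one_iff power_mult)

lemma pentagonal_exponent_Suc: "(3 * (Suc n)\<^sup>2 - Suc n) div 2 = (3 * n\<^sup>2 - n) div 2 + (3 * n + 1)"
proof -
  have "n \<le> 3 * n\<^sup>2" by (cases n) (simp_all add: power2_eq_square)
  hence "3 * (Suc n)\<^sup>2 - Suc n = (3 * n\<^sup>2 - n) + (3 * n + 1) * 2"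
    by (simp add: power2_eq_square algebra_simps)
  thus ?thesis by simp
qed

lemma pentagonal_exponent_ge:
  fixes n :: nat
  shows "n \<le> (3 * n\<^sup>2 - n) div 2"
proof (induction n)
  case (Suc n)
  thus ?case unfolding pentagonal_exponent_Suc by simp
qed simp

lemma pentagonal_term_bound:
  assumes q: "norm q < 1"
  obtains C where "\<And>m n. norm (pentagonal_term q m n) \<le> C * norm q ^ ((m + 1) * n)"
proof -
  obtain A where A: "A > 0" "\<And>n. norm (1 / qpoch q q n) \<le> A"
    using inverse_qpoch_bounded[OF q q] by blast
  obtain B where B: "B > 0" "\<And>j. norm (qpoch_inf (q ^ (2 * j + 1)) (q\<^sup>2)) \<le> B"
    using convergent_norm_bounded[OF pentagonal_tail[OF q]] by blast
  show ?thesis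
  proof (rule that)
    fix m n :: nat
    have E: "(m + 1) * n \<le> (3 * n\<^sup>2 - n) div 2 + 2 * m * n"
      using pentagonal_exponent_ge[of n] by (simp add: algebra_simps)
    have "norm (pentagonal_term q m n) = norm q ^ ((3 * n\<^sup>2 - n) div 2 + 2 * m * n)
        * (norm (1 / qpoch q q n) * norm (qpoch_inf (q ^ (2 * (m + n) + 1)) (q\<^sup>2)))"
      by (simp add: pentagonal_term_def norm_mult norm_divide norm_power)
    also have "\<dots> \<le> norm q ^ ((m + 1) * n) * (A * B)"
      using q A B(1) B(2)[of "m + n"] E by (intro mult_mono power_decreasing) (auto intro: less_imp_le)
    finally show "norm (pentagonal_term q m n) \<le> (A * B) * norm q ^ ((m + 1) * n)"
      by (simp add: mult_ac)
  qed
qed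

lemma summable_pentagonal_term:
  assumes q: "norm q < 1"
  shows "summable (pentagonal_term q m)"
proof -
  obtain C where "\<And>m n. norm (pentagonal_term q m n) \<le> C * norm q ^ ((m + 1) * n)"
    using pentagonal_term_bound[OF q] by blast
  thus ?thesis using dominated_series_summable[of "norm q" "pentagonal_term q" C m] q by simp
qed

lemma pentagonal_sum_tendsto:
  assumes q: "norm q < 1"
  shows "(\<lambda>m. suminf (pentagonal_term q m)) \<longlonglongrightarrow> 1"
proof -
  obtain C where "\<And>m n. norm (pentagonal_term q m n) \<le> C * norm q ^ ((m + 1) * n)"
    using pentagonal_term_bound[OF q] by blast
  moreover have "(\<lambda>m. pentagonal_term q m 0) \<longlonglongrightarrow> 1"
    using pentagonal_tail[OF q] by (simp add: pentagonal_term_def)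
  ultimately show ?thesis using dominated_series_tendsto[of "norm q" "pentagonal_term q" C] q by simp
qed

text \<open>
  Put \<open>Y = q\<^bsup>2m\<^esup> N\<^sup>2\<close>, \<open>N = q\<^sup>n\<close>. The defect has the factor
  \<open>(1 - Y q) (1 - Y q\<^sup>3) - N\<^sup>2 (1 - Y q\<^sup>3) - Y N\<^sup>2 q\<^sup>2\<close>, and
  \<open>d n\<close> is found by the ansatz \<open>(1 - N) (1 + N + \<beta> Y) (1 - Y q\<^sup>3)\<close> for its corresponding factor:
  comparing coefficients of \<open>Y\<close> gives \<open>\<beta> = - q\<close>. The division in the definition of \<open>d\<close> removes the factor
  \<open>1 - Y q\<close> that the summand contains in addition.
\<close>

lemma pentagonal_sum_recurrence:
  assumes q: "norm q < 1"
  shows "rr_recurrence (q\<^sup>2) (\<lambda>m. suminf (pentagonal_term q m))"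
  unfolding rr_recurrence_def
proof
  fix m
  have q2: "norm (q\<^sup>2) < 1" using q by (simp add: norm_power power_less_one_iff)
  define d where "d = (\<lambda>n. pentagonal_term q m n * ((1 - q ^ n) * (1 + q ^ n - q ^ (2 * m + 1) * (q ^ n * q ^ n))
       / (1 - q ^ (2 * m + 1) * (q ^ n * q ^ n))))"
  show "suminf (pentagonal_term q m) = suminf (pentagonal_term q (m + 1)) + (q\<^sup>2) ^ (m + 1) * suminf (pentagonal_term q (m + 2))"
  proof (rule suminf_telescoping)
    have N0: "(\<lambda>n. q ^ n) \<longlonglongrightarrow> 0"
      using q by (intro LIMSEQ_power_zero)
    have "d \<longlonglongrightarrow> 0 * ((1 - 0) * (1 + 0 - q ^ (2 * m + 1) * (0 * 0)) / (1 - q ^ (2 * m + 1) * (0 * 0)))"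
      unfolding d_def
      by (intro tendsto_mult tendsto_divide tendsto_add tendsto_diff tendsto_const N0
          summable_LIMSEQ_zero summable_pentagonal_term q) auto
    thus "d \<longlonglongrightarrow> 0" by simp
    show "d 0 = 0" by (simp add: d_def)
    fix n
    define y where "y = q ^ (2 * m)"
    define N where "N = q ^ n"
    define E where "E = qpoch_inf (q ^ (2 * (m + n) + 5)) (q\<^sup>2)"
    define P where "P = qpoch q q n"
    define c where "c = q ^ ((3 * n\<^sup>2 - n) div 2 + 2 * m * n) / P"
    have E1: "qpoch_inf (q ^ (2 * (m + n) + 3)) (q\<^sup>2) = (1 - y * N * N * q * q * q) * E"
      using qpoch_inf_tail_Suc[OF q2, of "q ^ (2 * (m + n) + 3)"]
      by (simp add: E_def y_def N_def power_add mult_2 mult_2_right numeral_eq_Suc mult_ac)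
    have E0: "qpoch_inf (q ^ (2 * (m + n) + 1)) (q\<^sup>2) = (1 - y * N * N * q) * ((1 - y * N * N * q * q * q) * E)"
      unfolding E1 [symmetric]
      using qpoch_inf_tail_Suc[OF q2, of "q ^ (2 * (m + n) + 1)"]
      by (simp add: y_def N_def power_add mult_2 mult_2_right numeral_eq_Suc mult_ac)
    have nz: "1 - N * q \<noteq> 0" "1 - y * N * N * q \<noteq> 0" "1 - y * N * N * q * q * q \<noteq> 0"
      using power_ne_1_complex[OF q, of "n + 1"] power_ne_1_complex[OF q, of "2 * m + n + n + 1"]
        power_ne_1_complex[OF q, of "2 * m + n + n + 3"]
      by (simp_all add: N_def y_def power_add mult_2 mult_2_right mult_ac numeral_3_eq_3)
    have t0: "pentagonal_term q m n = c * ((1 - y * N * N * q) * ((1 - y * N * N * q * q * q) * E))"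
      unfolding pentagonal_term_def E0 by (simp add: c_def P_def)
    have "pentagonal_term q (m + 1) n = c * q ^ (2 * n) * qpoch_inf (q ^ (2 * (m + n) + 3)) (q\<^sup>2)"
      by (simp add: pentagonal_term_def c_def P_def power_add algebra_simps numeral_3_eq_3)
    hence t1: "pentagonal_term q (m + 1) n = c * (N * N) * ((1 - y * N * N * q * q * q) * E)"
      unfolding E1 by (simp add: N_def mult_2 mult_2_right power_add)
    have s: "2 * (m + 2 + n) + 1 = 2 * (m + n) + 5"
      "(3 * n\<^sup>2 - n) div 2 + 2 * (m + 2) * n = ((3 * n\<^sup>2 - n) div 2 + 2 * m * n) + 4 * n"
      by (simp_all add: algebra_simps)
    have "pentagonal_term q (m + 2) n = c * q ^ (4 * n) * E"
      unfolding pentagonal_term_def s E_def [symmetric] power_add[of q "(3 * n\<^sup>2 - n) div 2 + 2 * m * n"]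
      by (simp add: c_def P_def)
    moreover have "q ^ (4 * n) = N * N * N * N"
    proof -
      have e: "4 * n = n + n + n + n" by simp
      show ?thesis unfolding e power_add N_def by simp
    qed
    ultimately have t2: "pentagonal_term q (m + 2) n = c * (N * N * N * N) * E"
      by simp
    have ex: "(3 * (Suc n)\<^sup>2 - Suc n) div 2 + 2 * m * Suc n = ((3 * n\<^sup>2 - n) div 2 + 2 * m * n) + (3 * n + 1 + 2 * m)"
      unfolding pentagonal_exponent_Suc by simp
    have pw: "q ^ (3 * n + 1 + 2 * m) = N * N * N * q * y"
    proof -
      have e: "3 * n + 1 + 2 * m = n + n + n + 1 + 2 * m" by simp
      show ?thesis unfolding e power_add N_def y_def by simp
    qed
    have t3: "pentagonal_term q m (Suc n) * (1 - N * q)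
        = c * (N * N * N * q * y) * ((1 - y * N * N * q * q * q) * E)"
    proof -
      have Ps: "qpoch q q (Suc n) = P * (1 - N * q)"
        by (simp add: qpoch_Suc P_def N_def mult_ac)
      have E2: "qpoch_inf (q ^ (2 * (m + Suc n) + 1)) (q\<^sup>2) = (1 - y * N * N * q * q * q) * E"
        unfolding E1 [symmetric] by (simp add: numeral_3_eq_3)
      show ?thesis
        unfolding pentagonal_term_def ex power_add[of q "(3 * n\<^sup>2 - n) div 2 + 2 * m * n"] pw Ps E2 c_def
        using nz by (simp add: mult_ac)
    qed
    have "(q\<^sup>2) ^ (m + 1) = y * q * q"
      unfolding y_def power_mult power_add by (simp add: power2_eq_square)
    moreover have "q ^ Suc n = N * q" "q ^ (2 * m + 1) = y * q"
      by (simp_all add: N_def y_def)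
    ultimately have pws: "q ^ Suc n = N * q" "q ^ (2 * m + 1) = y * q" "(q\<^sup>2) ^ (m + 1) = y * q * q"
      by blast+
    have dn: "d n = c * ((1 - N) * (1 + N - y * N * N * q) * ((1 - y * N * N * q * q * q) * E))"
      using nz unfolding d_def t0 pws N_def [symmetric] by (simp add: mult_ac)
    have "d (Suc n) = (pentagonal_term q m (Suc n) * (1 - N * q)) * ((1 + N * q - y * q * (N * q * (N * q)))
       / (1 - y * q * (N * q * (N * q))))"
      unfolding d_def pws by simp
    also have "\<dots> = c * (N * N * N * q * y) * (1 + N * q - y * N * N * q * q * q) * E"
      unfolding t3 using nz by (simp add: mult_ac)
    finally have dn1: "d (Suc n) = c * (N * N * N * q * y) * (1 + N * q - y * N * N * q * q * q) * E" .
    show "pentagonal_term q m n - pentagonal_term q (m + 1) n - (q\<^sup>2) ^ (m + 1) * pentagonal_term q (m + 2) n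
       = d n - d (Suc n)"
      unfolding dn dn1 pws t1 t2 t0 by (simp add: algebra_simps)
  qed (intro summable_pentagonal_term q)+
qed


section \<open>The theta-like series of Rogers and Ramanujan\<close>

text \<open>
  The functions \<open>H\<^sub>1\<close> and \<open>H\<^sub>2\<close> of the classical proof of the Rogers--Ramanujan identities (as given
  by Hardy and Wright), at \<open>a = q\<^bsup>m + 1\<^esup>\<close>:
  \<open>H\<^sub>k(a) = \<Sum>r. (-1)\<^sup>r a\<^bsup>2r\<^esup> q\<^bsup>r (5r + 1) / 2 - k r\<^esup> (1 - a\<^sup>k q\<^bsup>2 k r\<^esup>) / ((q; q)\<^sub>r (a q\<^sup>r; q)\<^sub>\<infinity>)\<close>.
  They satisfy \<open>H\<^sub>1(a) = H\<^sub>2(a q)\<close> and \<open>H\<^sub>2(a) - H\<^sub>1(a) = a H\<^sub>1(a q)\<close>, which together give the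
  recurrence for \<open>H\<^sub>2\<close>; at \<open>a = q\<close> they are theta series over \<open>(q; q)\<^sub>\<infinity>\<close>. The weight
  below is the part of the \<open>H\<^sub>2\<close> summand without its factor \<open>1 - a\<^sup>2 q\<^bsup>4r\<^esup>\<close>.
\<close>

definition hw_weight :: "complex \<Rightarrow> nat \<Rightarrow> nat \<Rightarrow> complex" where
  "hw_weight q m r = (-1) ^ r * q ^ ((5 * r\<^sup>2 + r) div 2 + 2 * m * r)
     / (qpoch q q r * qpoch_inf (q ^ (m + r + 1)) q)"

definition hw1_term :: "complex \<Rightarrow> nat \<Rightarrow> nat \<Rightarrow> complex" where
  "hw1_term q m r = hw_weight q m r * (q ^ r * (1 - q ^ (m + 1 + 2 * r)))"

definition hw2_term :: "complex \<Rightarrow> nat \<Rightarrow> nat \<Rightarrow> complex" where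
  "hw2_term q m r = hw_weight q m r * (1 - q ^ (2 * (m + 1 + 2 * r)))"

lemma theta_exponent_Suc: "(5 * (Suc r)\<^sup>2 + Suc r) div 2 = (5 * r\<^sup>2 + r) div 2 + (5 * r + 3)"
proof -
  have "5 * (Suc r)\<^sup>2 + Suc r = (5 * r\<^sup>2 + r) + (5 * r + 3) * 2"
    by (simp add: power2_eq_square algebra_simps)
  thus ?thesis by simp
qed

lemma theta_exponent_ge:
  fixes r :: nat
  shows "r \<le> (5 * r\<^sup>2 + r) div 2"
proof (induction r)
  case (Suc r)
  thus ?case unfolding theta_exponent_Suc by simp
qed simp

lemma hw_tail:
  assumes "norm q < 1"
  shows "(\<lambda>j. qpoch_inf (q ^ (j + 1)) q) \<longlonglongrightarrow> 1"
  using qpoch_inf_shift_tendsto_1[OF assms assms] by simp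

lemma hw_weight_bound:
  assumes q: "norm q < 1"
  obtains C where "C > 0" "\<And>m n. norm (hw_weight q m n) \<le> C * norm q ^ ((m + 1) * n)"
proof -
  obtain A where A: "A > 0" "\<And>n. norm (1 / qpoch q q n) \<le> A"
    using inverse_qpoch_bounded[OF q q] by blast
  have "(\<lambda>j. 1 / qpoch_inf (q ^ (j + 1)) q) \<longlonglongrightarrow> 1 / 1"
    by (rule tendsto_divide[OF tendsto_const hw_tail[OF q]]) simp
  then obtain B where B: "B > 0" "\<And>j. norm (1 / qpoch_inf (q ^ (j + 1)) q) \<le> B"
    using convergent_norm_bounded by blast
  show ?thesis
  proof (rule that)
    show "A * B > 0" using A B by simp
    fix m n :: nat
    have E: "(m + 1) * n \<le> (5 * n\<^sup>2 + n) div 2 + 2 * m * n"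
      using theta_exponent_ge[of n] by (simp add: algebra_simps)
    have "norm (hw_weight q m n) = norm q ^ ((5 * n\<^sup>2 + n) div 2 + 2 * m * n)
        * (norm (1 / qpoch q q n) * norm (1 / qpoch_inf (q ^ (m + n + 1)) q))"
      by (simp add: hw_weight_def norm_mult norm_divide norm_power)
    also have "\<dots> \<le> norm q ^ ((m + 1) * n) * (A * B)"
      using q A B(1) B(2)[of "m + n"] E by (intro mult_mono power_decreasing) (auto intro: less_imp_le)
    finally show "norm (hw_weight q m n) \<le> (A * B) * norm q ^ ((m + 1) * n)"
      by (simp add: mult_ac)
  qed
qed

lemma hw_term_bound:
  assumes q: "norm q < 1"
  obtains C where "\<And>m n. norm (hw1_term q m n) \<le> C * norm q ^ ((m + 1) * n)"
    "\<And>m n. norm (hw2_term q m n) \<le> C * norm q ^ ((m + 1) * n)"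
proof -
  obtain C where C: "C > 0" "\<And>m n. norm (hw_weight q m n) \<le> C * norm q ^ ((m + 1) * n)"
    using hw_weight_bound[OF q] by blast
  have le1: "norm (q ^ k) \<le> 1" for k
    using q by (simp add: norm_power power_le_one)
  have le2: "norm (1 - q ^ k) \<le> 2" for k
    using norm_triangle_ineq4[of 1 "q ^ k"] le1[of k] by simp
  have *: "norm (hw_weight q m n * t) \<le> (C * 2) * norm q ^ ((m + 1) * n)" if "norm t \<le> 2" for t m n
  proof -
    have "norm (hw_weight q m n) * norm t \<le> (C * norm q ^ ((m + 1) * n)) * 2"
      using C that by (intro mult_mono) (auto intro: less_imp_le)
    thus ?thesis by (simp add: norm_mult mult_ac)
  qed
  show ?thesis
  proof (rule that)
    fix m n
    have "norm (q ^ n) * norm (1 - q ^ (m + 1 + 2 * n)) \<le> 1 * 2"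
      using le1[of n] le2[of "m + 1 + 2 * n"] by (intro mult_mono) simp_all
    hence "norm (q ^ n * (1 - q ^ (m + 1 + 2 * n))) \<le> 2"
      by (simp only: norm_mult mult_1)
    thus "norm (hw1_term q m n) \<le> (C * 2) * norm q ^ ((m + 1) * n)"
      unfolding hw1_term_def by (rule *)
    show "norm (hw2_term q m n) \<le> (C * 2) * norm q ^ ((m + 1) * n)"
      unfolding hw2_term_def by (rule *[OF le2])
  qed
qed

lemma summable_hw_term:
  assumes q: "norm q < 1"
  shows "summable (hw1_term q m)" "summable (hw2_term q m)" "hw_weight q m \<longlonglongrightarrow> 0"
proof -
  obtain C where C: "\<And>m n. norm (hw1_term q m n) \<le> C * norm q ^ ((m + 1) * n)"
      "\<And>m n. norm (hw2_term q m n) \<le> C * norm q ^ ((m + 1) * n)"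
    using hw_term_bound[OF q] by blast
  show "summable (hw1_term q m)" "summable (hw2_term q m)"
    by (rule dominated_series_summable[OF norm_ge_zero q C(1)])
       (rule dominated_series_summable[OF norm_ge_zero q C(2)])
  obtain D where D: "D > 0" "\<And>m n. norm (hw_weight q m n) \<le> D * norm q ^ ((m + 1) * n)"
    using hw_weight_bound[OF q] by blast
  from dominated_series_summable[OF norm_ge_zero q D(2)] show "hw_weight q m \<longlonglongrightarrow> 0"
    by (rule summable_LIMSEQ_zero)
qed

lemma hw2_sum_tendsto:
  assumes q: "norm q < 1"
  shows "(\<lambda>m. suminf (hw2_term q m)) \<longlonglongrightarrow> 1"
proof -
  obtain C where C: "\<And>m n. norm (hw1_term q m n) \<le> C * norm q ^ ((m + 1) * n)"
      "\<And>m n. norm (hw2_term q m n) \<le> C * norm q ^ ((m + 1) * n)"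
    using hw_term_bound[OF q] by blast
  have "(\<lambda>m. hw2_term q m 0) \<longlonglongrightarrow> 1"
  proof -
    have "norm (q\<^sup>2) < 1" using q by (simp add: norm_power power_less_one_iff)
    from LIMSEQ_Suc[OF LIMSEQ_power_zero[OF this]]
    have "(\<lambda>m. (q\<^sup>2) ^ Suc m) \<longlonglongrightarrow> 0" .
    from tendsto_divide[OF tendsto_diff[OF tendsto_const[of 1] this] hw_tail[OF q]]
    have "(\<lambda>m. (1 - (q\<^sup>2) ^ Suc m) / qpoch_inf (q ^ (m + 1)) q) \<longlonglongrightarrow> 1"
      by (simp only: diff_zero div_by_1 one_neq_zero not_False_eq_True simp_thms)
    moreover have "hw2_term q m 0 = (1 - (q\<^sup>2) ^ Suc m) / qpoch_inf (q ^ (m + 1)) q" for m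
    proof -
      have "(q\<^sup>2) ^ Suc m = q ^ (2 * (m + 1 + 2 * 0))" by (subst power_mult) simp
      thus ?thesis by (simp add: hw2_term_def hw_weight_def)
    qed
    ultimately show ?thesis by simp
  qed
  thus ?thesis by (rule dominated_series_tendsto[OF norm_ge_zero q C(2)])
qed

text \<open>
  Both relations need the weights for \<open>(m, r)\<close>, \<open>(m + 1, r)\<close> and \<open>(m, r + 1)\<close>; \<open>g\<close> is their
  common part.
\<close>

lemma hw_shift:
  fixes q :: complex and m r :: nat
  assumes q: "norm q < 1"
  defines "x \<equiv> q ^ m" and "N \<equiv> q ^ r"
  obtains g where
    "hw_weight q m r * (1 - x * N * q) = g"
    "hw_weight q (m + 1) r = N * N * g"
    "hw_weight q m (Suc r) * (1 - N * q) = - (g * (N * N * N * N * N * x * x * q * q * q))"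
proof -
  define g where "g = (-1) ^ r * q ^ ((5 * r\<^sup>2 + r) div 2 + 2 * m * r)
    / (qpoch q q r * qpoch_inf (q ^ (m + r + 2)) q)"
  have nz: "1 - x * N * q \<noteq> 0" "1 - N * q \<noteq> 0"
    using power_ne_1_complex[OF q, of "m + r + 1"] power_ne_1_complex[OF q, of "r + 1"]
    by (simp_all add: x_def N_def power_add mult_ac)
  have E: "qpoch_inf (q ^ (m + r + 1)) q = (1 - x * N * q) * qpoch_inf (q ^ (m + r + 2)) q"
    using qpoch_inf_tail_Suc[OF q, of "q ^ (m + r + 1)"] by (simp add: x_def N_def power_add mult_ac)
  show ?thesis
  proof (rule that)
    show "hw_weight q m r * (1 - x * N * q) = g"
      unfolding hw_weight_def E g_def using nz by (simp add: mult_ac)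
    show "hw_weight q (m + 1) r = N * N * g"
      unfolding hw_weight_def g_def
      by (simp add: N_def power_add algebra_simps mult_2 mult_2_right)
    have ex: "(5 * (Suc r)\<^sup>2 + Suc r) div 2 + 2 * m * Suc r
       = ((5 * r\<^sup>2 + r) div 2 + 2 * m * r) + (5 * r + 3 + 2 * m)"
      unfolding theta_exponent_Suc by simp
    have pw: "q ^ (5 * r + 3 + 2 * m) = N * N * N * N * N * x * x * q * q * q"
    proof -
      have e: "5 * r + 3 + 2 * m = r + r + r + r + r + m + m + 1 + 1 + 1" by simp
      show ?thesis unfolding e power_add N_def x_def by simp
    qed
    have Ps: "qpoch q q (Suc r) = qpoch q q r * (1 - N * q)"
      by (simp add: qpoch_Suc N_def mult_ac)
    have Es: "qpoch_inf (q ^ (m + Suc r + 1)) q = qpoch_inf (q ^ (m + r + 2)) q" by simp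
    show "hw_weight q m (Suc r) * (1 - N * q) = - (g * (N * N * N * N * N * x * x * q * q * q))"
      unfolding hw_weight_def ex power_add[of q "(5 * r\<^sup>2 + r) div 2 + 2 * m * r"] pw Ps Es g_def
      using nz by (simp add: mult_ac)
  qed
qed

text \<open>
  With \<open>a = q\<^bsup>m + 1\<^esup>\<close>, the telescoping comes from splitting
  \<open>1 - a q\<^bsup>2r\<^esup> = (1 - q\<^sup>r) + q\<^sup>r (1 - a q\<^sup>r)\<close>: the first part cancels the last factor of
  \<open>(q; q)\<^sub>r\<close>, the second one the first factor of \<open>(a q\<^sup>r; q)\<^sub>\<infinity>\<close>.
\<close>

lemma hw1_sum_eq:
  assumes q: "norm q < 1"
  shows "suminf (hw1_term q m) = suminf (hw2_term q (m + 1))"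
proof -
  define d where "d = (\<lambda>r. hw_weight q m r * (q ^ r * (1 - q ^ r)))"
  have "suminf (hw1_term q m) = suminf (hw2_term q (m + 1)) + 0 * suminf (hw2_term q m)"
  proof (rule suminf_telescoping)
    have N0: "(\<lambda>n. q ^ n) \<longlonglongrightarrow> 0"
      using q by (intro LIMSEQ_power_zero)
    have "d \<longlonglongrightarrow> 0 * (0 * (1 - 0))"
      unfolding d_def by (intro tendsto_mult tendsto_diff tendsto_const N0 summable_hw_term q)
    thus "d \<longlonglongrightarrow> 0" by simp
    show "d 0 = 0" by (simp add: d_def)
    fix r
    define x where "x = q ^ m"
    define N where "N = q ^ r"
    obtain g where g: "hw_weight q m r * (1 - x * N * q) = g"
      "hw_weight q (m + 1) r = N * N * g"
      "hw_weight q m (Suc r) * (1 - N * q) = - (g * (N * N * N * N * N * x * x * q * q * q))"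
      using hw_shift[OF q, of m r] unfolding x_def N_def by blast
    have pws: "q ^ (m + 1 + 2 * r) = x * q * N * N" "q ^ Suc r = N * q"
       "q ^ (2 * (m + 1 + 1 + 2 * r)) = x * x * N * N * N * N * q * q * q * q"
    proof -
      have e: "m + 1 + 2 * r = m + 1 + r + r" "Suc r = r + 1" "2 * (m + 1 + 1 + 2 * r) = m + m + r + r + r + r + 1 + 1 + 1 + 1" by simp_all
      show "q ^ (m + 1 + 2 * r) = x * q * N * N" "q ^ Suc r = N * q"
       "q ^ (2 * (m + 1 + 1 + 2 * r)) = x * x * N * N * N * N * q * q * q * q"
        unfolding e power_add N_def x_def by simp_all
    qed
    have "hw1_term q m r - d r = N * N * (hw_weight q m r * (1 - x * N * q))"
      unfolding hw1_term_def d_def pws N_def [symmetric] by (simp add: algebra_simps)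
    hence 1: "hw1_term q m r - d r = N * N * g" by (simp only: g)
    have "d (Suc r) = N * q * (hw_weight q m (Suc r) * (1 - N * q))"
      unfolding d_def pws by simp
    hence 2: "d (Suc r) = N * q * (- (g * (N * N * N * N * N * x * x * q * q * q)))" by (simp only: g)
    have 3: "hw2_term q (m + 1) r = N * N * g * (1 - x * x * N * N * N * N * q * q * q * q)"
      unfolding hw2_term_def pws g ..
    show "hw1_term q m r - hw2_term q (m + 1) r - 0 * hw2_term q m r = d r - d (Suc r)"
      using 1 unfolding 2 3 by (simp add: algebra_simps)
  qed (intro summable_hw_term q)+
  thus ?thesis by simp
qed

text \<open>
  The same splitting for
  \<open>(1 - a\<^sup>2 q\<^bsup>4r\<^esup>) - q\<^sup>r (1 - a q\<^bsup>2r\<^esup>) = (1 - q\<^sup>r) + a q\<^bsup>3r\<^esup> (1 - a q\<^sup>r)\<close>.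
\<close>

lemma hw2_sum_eq:
  assumes q: "norm q < 1"
  shows "suminf (hw2_term q m) = suminf (hw1_term q m) + q ^ (m + 1) * suminf (hw1_term q (m + 1))"
proof -
  define d where "d = (\<lambda>r. hw_weight q m r * (1 - q ^ r))"
  show ?thesis
  proof (rule suminf_telescoping)
    have N0: "(\<lambda>n. q ^ n) \<longlonglongrightarrow> 0"
      using q by (intro LIMSEQ_power_zero)
    have "d \<longlonglongrightarrow> 0 * (1 - 0)"
      unfolding d_def by (intro tendsto_mult tendsto_diff tendsto_const N0 summable_hw_term q)
    thus "d \<longlonglongrightarrow> 0" by simp
    show "d 0 = 0" by (simp add: d_def)
    fix r
    define x where "x = q ^ m"
    define N where "N = q ^ r"
    obtain g where g: "hw_weight q m r * (1 - x * N * q) = g"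
      "hw_weight q (m + 1) r = N * N * g"
      "hw_weight q m (Suc r) * (1 - N * q) = - (g * (N * N * N * N * N * x * x * q * q * q))"
      using hw_shift[OF q, of m r] unfolding x_def N_def by blast
    have pws: "q ^ (m + 1 + 2 * r) = x * q * N * N" "q ^ Suc r = N * q" "q ^ (m + 1) = x * q"
       "q ^ (2 * (m + 1 + 2 * r)) = x * x * N * N * N * N * q * q"
       "q ^ (m + 1 + 1 + 2 * r) = x * q * q * N * N"
    proof -
      have e: "m + 1 + 2 * r = m + 1 + r + r" "Suc r = r + 1" "2 * (m + 1 + r + r) = m + m + r + r + r + r + 1 + 1" "m + 1 + 1 + 2 * r = m + 1 + 1 + r + r" by simp_all
      show "q ^ (m + 1 + 2 * r) = x * q * N * N" "q ^ Suc r = N * q" "q ^ (m + 1) = x * q"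
       "q ^ (2 * (m + 1 + 2 * r)) = x * x * N * N * N * N * q * q"
       "q ^ (m + 1 + 1 + 2 * r) = x * q * q * N * N"
        unfolding e power_add N_def x_def by simp_all
    qed
    have "hw2_term q m r - hw1_term q m r - d r = x * q * N * N * N * (hw_weight q m r * (1 - x * N * q))"
      unfolding hw1_term_def hw2_term_def d_def pws N_def [symmetric] by (simp add: algebra_simps)
    hence 1: "hw2_term q m r - hw1_term q m r - d r = x * q * N * N * N * g" by (simp only: g)
    have "d (Suc r) = hw_weight q m (Suc r) * (1 - N * q)"
      unfolding d_def pws by simp
    hence 2: "d (Suc r) = - (g * (N * N * N * N * N * x * x * q * q * q))" by (simp only: g)
    have 3: "hw1_term q (m + 1) r = N * N * g * (N * (1 - x * q * q * N * N))"
      unfolding hw1_term_def pws g N_def [symmetric] ..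
    have "hw2_term q m r - hw1_term q m r = d r + x * q * N * N * N * g" using 1 by (simp add: algebra_simps)
    thus "hw2_term q m r - hw1_term q m r - q ^ (m + 1) * hw1_term q (m + 1) r = d r - d (Suc r)"
      unfolding 2 3 pws by (simp add: algebra_simps)
  qed (intro summable_hw_term q)+
qed

lemma hw2_sum_recurrence:
  assumes q: "norm q < 1"
  shows "rr_recurrence q (\<lambda>m. suminf (hw2_term q m))"
  unfolding rr_recurrence_def
proof
  fix m
  have "suminf (hw1_term q (m + 1)) = suminf (hw2_term q (m + 2))"
    using hw1_sum_eq[OF q, of "m + 1"] by simp
  with hw2_sum_eq[OF q, of m] hw1_sum_eq[OF q, of m]
  show "suminf (hw2_term q m) = suminf (hw2_term q (m + 1)) + q ^ (m + 1) * suminf (hw2_term q (m + 2))"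
    by simp
qed

section \<open>Schur polynomials\<close>

lemma gauss_binomial_eq_0: "k < 0 \<or> n < k \<Longrightarrow> gauss_binomial q n k = 0"
  by (auto simp: gauss_binomial_def)

lemma gauss_binomial_0: "norm q < 1 \<Longrightarrow> 0 \<le> n \<Longrightarrow> gauss_binomial q n 0 = 1"
  by (simp add: gauss_binomial_def qpoch_nonzero)

lemma gauss_binomial_self: "norm q < 1 \<Longrightarrow> 0 \<le> n \<Longrightarrow> gauss_binomial q n n = 1"
  by (simp add: gauss_binomial_def qpoch_nonzero)

lemma gauss_binomial_Pascal:
  assumes q: "norm q < 1" and n: "n \<ge> 1"
  shows "gauss_binomial q n k = gauss_binomial q (n - 1) k
    + q ^ nat (n - k) * gauss_binomial q (n - 1) (k - 1)"
proof -
  consider "k < 0 \<or> n < k" | "k = 0" | "k = n" | "0 < k" "k < n" by linarith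
  thus ?thesis
  proof cases
    case 4
    define a where "a = nat (k - 1)"
    define b where "b = nat (n - k - 1)"
    have nk: "nat n = Suc (Suc (a + b))" "nat k = Suc a" "nat (n - k) = Suc b" "nat (n - 1) = Suc (a + b)"
      "nat (n - 1 - k) = b" "nat (k - 1) = a" "nat (n - 1 - (k - 1)) = Suc b"
      using 4 by (simp_all add: a_def b_def)
    define A where "A = qpoch q q a"
    define B where "B = qpoch q q b"
    define x where "x = q ^ Suc a"
    define y where "y = q ^ Suc b"
    have S: "qpoch q q (Suc j) = qpoch q q j * (1 - q ^ Suc j)" for j by (simp add: qpoch_Suc)
    have nz: "A \<noteq> 0" "B \<noteq> 0" "1 - x \<noteq> 0" "1 - y \<noteq> 0"
      using qpoch_nonzero[OF q q] qpoch_factor_nonzero[OF q q, of a] qpoch_factor_nonzero[OF q q, of b]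
      by (simp_all add: A_def B_def x_def y_def)
    have xy: "q ^ Suc (Suc (a + b)) = x * y" by (simp add: x_def y_def power_add)
    have G: "gauss_binomial q n k = qpoch q q (Suc (a + b)) * (1 - x * y) / (A * (1 - x) * (B * (1 - y)))"
      "gauss_binomial q (n - 1) k = qpoch q q (Suc (a + b)) / (A * (1 - x) * B)"
      "gauss_binomial q (n - 1) (k - 1) = qpoch q q (Suc (a + b)) / (A * (B * (1 - y)))"
      using 4 unfolding gauss_binomial_def nk S[of "Suc (a + b)"] S[of a] S[of b] xy
      by (simp_all add: A_def B_def x_def y_def)
    define T where "T = qpoch q q (Suc (a + b))"
    have "T * (1 - x * y) / (A * (1 - x) * (B * (1 - y)))
      = T / (A * (1 - x) * B) + y * (T / (A * (B * (1 - y))))"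
      using nz by (simp add: divide_simps) (simp add: algebra_simps)
    thus ?thesis unfolding G nk T_def y_def .
  qed (use n q in \<open>auto simp: gauss_binomial_eq_0 gauss_binomial_0 gauss_binomial_self\<close>)
qed

text \<open>
  Both families of Schur polynomials at once: \<open>s = 0\<close> gives \<open>b\<^sub>m\<close>, and \<open>s = 1\<close> gives \<open>a\<^sub>m\<close>
  for \<open>m > 0\<close>.
\<close>

definition schur_sum :: "nat \<Rightarrow> nat \<Rightarrow> complex \<Rightarrow> complex" where
  "schur_sum s m q = (\<Sum>j\<le>m. q ^ (j\<^sup>2 + s * j) * gauss_binomial q (int m - int j - 1 - int s) (int j))"

text \<open>
  Split every Gaussian binomial by Pascal's rule and shift \<open>j\<close> in the second part. Pascal's rule fails
  only for the coefficient with both indices 0; \<open>s \<le> m\<close> keeps that one out of the sum.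
\<close>

lemma schur_sum_recurrence:
  assumes q: "norm q < 1" and m: "m \<ge> s"
  shows "schur_sum s (m + 2) q = schur_sum s (m + 1) q + q ^ m * schur_sum s m q"
proof -
  let ?e = "\<lambda>j. j\<^sup>2 + s * j" and ?G = "gauss_binomial q"
  have ext: "schur_sum s k q = (\<Sum>j\<le>M. q ^ ?e j * ?G (int k - int j - 1 - int s) (int j))"
    if "k \<le> M" for k M
    unfolding schur_sum_def using that
    by (intro sum.mono_neutral_left) (auto simp: gauss_binomial_eq_0)
  have P: "?G (int (m + 2) - int j - 1 - int s) (int j)
     = ?G (int (m + 1) - int j - 1 - int s) (int j)
       + q ^ nat (int m + 1 - int s - 2 * int j) * ?G (int m - int j - int s) (int j - 1)" for j
  proof (cases "int m + 1 - int j - int s \<ge> 1")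
    case True
    have e: "int m + 1 - int j - int s - int j = int m + 1 - int s - 2 * int j"
      "int m + 1 - int j - int s - 1 = int m - int j - int s"
      "int (m + 2) - int j - 1 - int s = int m + 1 - int j - int s"
      "int (m + 1) - int j - 1 - int s = int m - int j - int s" by simp_all
    show ?thesis using gauss_binomial_Pascal[OF q True, of "int j"] by (simp only: e)
  qed (use m in \<open>auto simp: gauss_binomial_eq_0\<close>)
  let ?h = "\<lambda>j. q ^ ?e j * (q ^ nat (int m + 1 - int s - 2 * int j) * ?G (int m - int j - int s) (int j - 1))"
  have "schur_sum s (m + 1) q = (\<Sum>j\<le>m+2. q ^ ?e j * ?G (int (m + 1) - int j - 1 - int s) (int j))"
    by (rule ext) simp
  hence "schur_sum s (m + 2) q = schur_sum s (m + 1) q + (\<Sum>j\<le>m+2. ?h j)"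
    by (simp only: schur_sum_def[of s "m + 2"] P distrib_left sum.distrib)
  also have "(\<Sum>j\<le>m+2. ?h j) = (\<Sum>j\<le>m+1. ?h (Suc j))"
    using sum.atMost_Suc_shift[of ?h "m + 1"] by (simp add: gauss_binomial_eq_0)
  also have "\<dots> = (\<Sum>j\<le>m+1. q ^ m * (q ^ ?e j * ?G (int m - int j - 1 - int s) (int j)))"
  proof (intro sum.cong refl)
    fix j
    have i: "int m - int (Suc j) - int s = int m - int j - 1 - int s" "int (Suc j) - 1 = int j" by simp_all
    show "?h (Suc j) = q ^ m * (q ^ ?e j * ?G (int m - int j - 1 - int s) (int j))"
    proof (cases "int j \<le> int m - int j - 1 - int s")
      case True
      have "int (nat (int m + 1 - int s - 2 * int (Suc j))) = int m + 1 - int s - 2 * int (Suc j)"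
        using True by simp
      hence "int (?e (Suc j) + nat (int m + 1 - int s - 2 * int (Suc j))) = int (m + ?e j)"
        unfolding of_nat_add by (simp add: power2_eq_square algebra_simps)
      hence "?e (Suc j) + nat (int m + 1 - int s - 2 * int (Suc j)) = m + ?e j"
        using of_nat_eq_iff by blast
      hence "q ^ ?e (Suc j) * q ^ nat (int m + 1 - int s - 2 * int (Suc j)) = q ^ m * q ^ ?e j"
        by (simp only: power_add [symmetric])
      thus ?thesis unfolding i by (simp only: mult.assoc [symmetric])
    qed (unfold i, simp add: gauss_binomial_eq_0)
  qed
  also have "\<dots> = q ^ m * schur_sum s m q"
    unfolding sum_distrib_left [symmetric] by (subst ext[of m "m + 1"]) simp_all
  finally show ?thesis .
qed

lemma schur_b_recurrence:
  assumes "norm q < 1"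
  shows "schur_b (m + 2) q = schur_b (m + 1) q + q ^ m * schur_b m q"
proof -
  have "schur_b k q = schur_sum 0 k q" for k by (simp add: schur_b_def schur_sum_def)
  thus ?thesis using schur_sum_recurrence[OF assms, of 0 m] by simp
qed

lemma schur_a_recurrence:
  assumes q: "norm q < 1"
  shows "schur_a (m + 2) q = schur_a (m + 1) q + q ^ m * schur_a m q"
proof -
  have a: "schur_a k q = schur_sum 1 k q" if "k > 0" for k
    using that by (simp add: schur_a_def schur_sum_def)
  show ?thesis
  proof (cases "m = 0")
    case True
    show ?thesis
      using q by (simp add: True schur_a_def numeral_2_eq_2 gauss_binomial_eq_0 gauss_binomial_0)
  next
    case False
    thus ?thesis using schur_sum_recurrence[OF q, of 1 m] by (simp add: a)
  qed
qed

lemma schur_initial: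
  assumes "norm q < 1"
  shows "schur_a 0 q = 1" "schur_a 1 q = 0" "schur_b 0 q = 0" "schur_b 1 q = 1"
  using assms
  by (simp_all add: schur_a_def schur_b_def gauss_binomial_eq_0 gauss_binomial_0)

text \<open>
  The right-hand side of the identities without the infinite product in front, and with arbitrary
  constants \<open>A\<close> and \<open>B\<close>; these are its values at \<open>m = 0\<close> and \<open>m = 1\<close>.
\<close>

definition schur_solution :: "complex \<Rightarrow> complex \<Rightarrow> complex \<Rightarrow> nat \<Rightarrow> complex" where
  "schur_solution q A B m = (-1) ^ m * (schur_a m q * A - schur_b m q * B) / q ^ (m choose 2)"

lemma schur_solution_recurrence:
  assumes q: "norm q < 1" "q \<noteq> 0"
  shows "rr_recurrence q (schur_solution q A B)"
  unfolding rr_recurrence_def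
proof
  fix m
  define T where "T = q ^ (m choose 2)"
  define x where "x = q ^ m"
  define a a' b b' where "a = schur_a m q" "a' = schur_a (m + 1) q" "b = schur_b m q" "b' = schur_b (m + 1) q"
  have nz: "T \<noteq> 0" "x \<noteq> 0" using q by (simp_all add: T_def x_def)
  have T: "q ^ ((m + 1) choose 2) = T * x" "q ^ ((m + 2) choose 2) = T * x * (x * q)" "q ^ (m + 1) = x * q"
    by (simp_all add: T_def x_def Suc_choose_2 power_add mult_ac)
  have ab: "schur_a (m + 2) q = a' + x * a" "schur_b (m + 2) q = b' + x * b"
    using schur_a_recurrence[OF q(1), of m] schur_b_recurrence[OF q(1), of m]
    by (simp_all add: a_a'_b_b'_def x_def)
  have h1: "schur_solution q A B (m + 1) = - ((-1) ^ m * (a' * A - b' * B) / (T * x))"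
    unfolding schur_solution_def T a_a'_b_b'_def by simp
  have h2: "q ^ (m + 1) * schur_solution q A B (m + 2)
      = (-1) ^ m * ((a' + x * a) * A - (b' + x * b) * B) / (T * x)"
    unfolding schur_solution_def T ab using nz q by simp
  have h3: "schur_solution q A B m = (-1) ^ m * (a * A - b * B) / T"
    unfolding schur_solution_def T_def a_a'_b_b'_def ..
  show "schur_solution q A B m
     = schur_solution q A B (m + 1) + q ^ (m + 1) * schur_solution q A B (m + 2)"
    unfolding h1 h2 h3 using nz by (simp add: divide_simps) (simp add: algebra_simps)
qed

section \<open>Initial values and conclusion\<close>

lemma qpoch_inf_dissect_5:
  assumes q: "norm q < 1"
  shows "qpoch_inf q q = qpoch_inf q (q ^ 5) * qpoch_inf (q ^ 2) (q ^ 5) * qpoch_inf (q ^ 3) (q ^ 5)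
    * qpoch_inf (q ^ 4) (q ^ 5) * qpoch_inf (q ^ 5) (q ^ 5)"
proof -
  have p: "norm (q ^ 5) < 1" using q by (simp add: norm_power power_less_one_iff)
  have "qpoch q q (5 * n) = qpoch q (q ^ 5) n * qpoch (q ^ 2) (q ^ 5) n * qpoch (q ^ 3) (q ^ 5) n
    * qpoch (q ^ 4) (q ^ 5) n * qpoch (q ^ 5) (q ^ 5) n" for n
  proof (induction n)
    case (Suc n)
    have e: "5 * Suc n = Suc (Suc (Suc (Suc (Suc (5 * n)))))" by simp
    have pw: "q * q ^ Suc (5 * n) = q ^ 2 * (q ^ 5) ^ n" "q * q ^ (5 * n) = q * (q ^ 5) ^ n"
       "q * q ^ Suc (Suc (5 * n)) = q ^ 3 * (q ^ 5) ^ n"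
       "q * q ^ Suc (Suc (Suc (5 * n))) = q ^ 4 * (q ^ 5) ^ n"
       "q * q ^ Suc (Suc (Suc (Suc (5 * n)))) = q ^ 5 * (q ^ 5) ^ n"
      unfolding power_mult [symmetric] power_Suc [symmetric] power_add [symmetric]
      by (simp_all add: numeral_eq_Suc)
    show ?case
      unfolding e qpoch_Suc Suc.IH pw by (simp only: mult_ac)
  qed simp
  hence "(\<lambda>n. qpoch q q (5 * n)) \<longlonglongrightarrow> qpoch_inf q (q ^ 5) * qpoch_inf (q ^ 2) (q ^ 5) * qpoch_inf (q ^ 3) (q ^ 5)
    * qpoch_inf (q ^ 4) (q ^ 5) * qpoch_inf (q ^ 5) (q ^ 5)"
    by (simp only:) (intro tendsto_mult qpoch_tendsto p)
  moreover have "strict_mono (\<lambda>n. 5 * n :: nat)" by (simp add: strict_mono_def)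
  hence "(\<lambda>n. qpoch q q (5 * n)) \<longlonglongrightarrow> qpoch_inf q q"
    using LIMSEQ_subseq_LIMSEQ[OF qpoch_tendsto[OF q]] by (force simp: o_def)
  ultimately show ?thesis using LIMSEQ_unique by blast
qed

lemma theta_exponent_choose: "(5 * k\<^sup>2 + k) div 2 = 5 * (k choose 2) + 3 * k"
proof (induction k)
  case (Suc k)
  thus ?case unfolding theta_exponent_Suc Suc_choose_2 by simp
qed (simp add: numeral_2_eq_2)

lemma hw_weight_0:
  assumes q: "norm q < 1"
  shows "hw_weight q 0 r = (-1) ^ r * q ^ (5 * (r choose 2) + 3 * r) / qpoch_inf q q"
  using qpoch_inf_split[OF q, of q r] unfolding hw_weight_def theta_exponent_choose by simp

text \<open>
  At \<open>a = q\<close> the two denominators combine to \<open>(q; q)\<^sub>\<infinity>\<close>, and the triple product with base \<open>q\<^sup>5\<close> and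
  \<open>z = q\<^sup>3\<close>, \<open>w = q\<^sup>2\<close> or \<open>z = q\<^sup>4\<close>, \<open>w = q\<close> sums the series. Three of the five residue
  classes of \<open>(q; q)\<^sub>\<infinity>\<close> modulo 5 cancel.
\<close>

lemma hw_sums_0:
  assumes q: "norm q < 1"
  shows "suminf (hw2_term q 0) = 1 / (qpoch_inf q (q ^ 5) * qpoch_inf (q ^ 4) (q ^ 5))" (is ?th2)
    and "suminf (hw1_term q 0) = 1 / (qpoch_inf (q ^ 2) (q ^ 5) * qpoch_inf (q ^ 3) (q ^ 5))" (is ?th1)
proof -
  define p where "p = q ^ 5"
  have le: "norm (q ^ Suc j) < 1" for j
    using q power_less_one_iff[of "norm q" "Suc j"] by (simp add: norm_power norm_mult)
  have p: "norm p < 1" using le[of 4] by (simp add: p_def eval_nat_numeral)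
  have "qpoch_inf (q ^ Suc j) p \<noteq> 0" for j by (intro qpoch_inf_nonzero p le)
  from this[of 0] this[of 1] this[of 2] this[of 3] this[of 4]
  have nz: "qpoch_inf q p \<noteq> 0" "qpoch_inf (q ^ 2) p \<noteq> 0" "qpoch_inf (q ^ 3) p \<noteq> 0"
    "qpoch_inf (q ^ 4) p \<noteq> 0" "qpoch_inf p p \<noteq> 0"
    by (simp_all add: p_def eval_nat_numeral)
  have D: "qpoch_inf q q = qpoch_inf q p * qpoch_inf (q ^ 2) p * qpoch_inf (q ^ 3) p
    * qpoch_inf (q ^ 4) p * qpoch_inf p p"
    using qpoch_inf_dissect_5[OF q] by (simp add: p_def)
  have "q ^ 3 * q ^ 2 = p" "q ^ 4 * q = p" by (simp_all add: p_def eval_nat_numeral)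
  note J = jacobi_triple_product[OF p this(1)] jacobi_triple_product[OF p this(2)]
  have "(-1) ^ k * (p ^ (k choose 2) * (q ^ 3) ^ k - p ^ (Suc k choose 2) * (q ^ 2) ^ Suc k) / qpoch_inf q q
     = hw2_term q 0 k" for k
  proof -
    have f1: "p ^ (k choose 2) * (q ^ 3) ^ k = q ^ (5 * (k choose 2) + 3 * k)"
      by (simp add: p_def power_add power_mult)
    have f2: "p ^ (Suc k choose 2) * (q ^ 2) ^ Suc k
       = q ^ (5 * (k choose 2) + 3 * k) * q ^ (2 * (0 + 1 + 2 * k))"
      unfolding p_def power_mult [symmetric] power_add [symmetric] Suc_choose_2
      by (rule arg_cong[where f = "\<lambda>i. q ^ i"]) simp
    show ?thesis unfolding hw2_term_def hw_weight_0[OF q] f1 f2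
      by (simp add: algebra_simps)
  qed
  with sums_divide[OF J(1), of "qpoch_inf q q"]
  have "hw2_term q 0 sums (qpoch_inf (q ^ 3) p * qpoch_inf (q ^ 2) p * qpoch_inf p p / qpoch_inf q q)"
    by simp
  thus ?th2 using nz unfolding p_def [symmetric] D by (simp add: sums_iff field_simps)
  have "(-1) ^ k * (p ^ (k choose 2) * (q ^ 4) ^ k - p ^ (Suc k choose 2) * q ^ Suc k) / qpoch_inf q q
     = hw1_term q 0 k" for k
  proof -
    have f1: "p ^ (k choose 2) * (q ^ 4) ^ k = q ^ (5 * (k choose 2) + 3 * k) * q ^ k"
      unfolding p_def power_mult [symmetric] power_add [symmetric]
      by (rule arg_cong[where f = "\<lambda>i. q ^ i"]) simp
    have f2: "p ^ (Suc k choose 2) * q ^ Suc k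
       = q ^ (5 * (k choose 2) + 3 * k) * q ^ k * q ^ (0 + 1 + 2 * k)"
      unfolding p_def power_mult [symmetric] power_add [symmetric] Suc_choose_2
      by (rule arg_cong[where f = "\<lambda>i. q ^ i"]) simp
    show ?thesis unfolding hw1_term_def hw_weight_0[OF q] f1 f2
      by (simp add: algebra_simps)
  qed
  with sums_divide[OF J(2), of "qpoch_inf q q"]
  have "hw1_term q 0 sums (qpoch_inf (q ^ 4) p * qpoch_inf q p * qpoch_inf p p / qpoch_inf q q)"
    by simp
  thus ?th1 using nz unfolding p_def [symmetric] D by (simp add: sums_iff field_simps)
qed

text \<open>
  The link between the two ends of the recurrence: the sums of \<open>hw2_term\<close> tend to 1 and their first
  two values are known, so that any solution tending to 1 is a known combination of Schur polynomials.
\<close>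

lemma rr_solution_unique:
  assumes q: "norm q < 1" "q \<noteq> 0" and f: "rr_recurrence q f" "f \<longlonglongrightarrow> 1"
  shows "f m = schur_solution q (1 / (qpoch_inf q (q ^ 5) * qpoch_inf (q ^ 4) (q ^ 5)))
    (1 / (qpoch_inf (q ^ 2) (q ^ 5) * qpoch_inf (q ^ 3) (q ^ 5))) m" (is "_ = schur_solution q ?A ?B m")
proof -
  let ?H = "\<lambda>m. suminf (hw2_term q m)"
  have H: "rr_recurrence q ?H" by (rule hw2_sum_recurrence[OF q(1)])
  have "f m = ?H m"
    by (rule rr_recurrence_eqI_limit[OF q(1) f H hw2_sum_tendsto[OF q(1)]])
  also have "?H m = schur_solution q ?A ?B m"
  proof (rule rr_recurrence_eqI_initial[OF q(2) H schur_solution_recurrence[OF q]])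
    show "?H 0 = schur_solution q ?A ?B 0"
      using schur_initial[OF q(1)] hw_sums_0(1)[OF q(1)] by (simp add: schur_solution_def numeral_2_eq_2)
    show "?H 1 = schur_solution q ?A ?B 1"
      using schur_initial[OF q(1)] hw_sums_0(2)[OF q(1)] hw1_sum_eq[OF q(1), of 0]
      by (simp add: schur_solution_def numeral_2_eq_2)
  qed
  finally show ?thesis .
qed

lemma qpoch_dissect_2: "qpoch a (p\<^sup>2) n * qpoch (a * p) (p\<^sup>2) n = qpoch a p (2 * n)"
proof (induction n)
  case (Suc n)
  have e: "2 * Suc n = Suc (Suc (2 * n))" by simp
  have f: "a * (p\<^sup>2) ^ n = a * p ^ (2 * n)" "a * p * (p\<^sup>2) ^ n = a * p ^ Suc (2 * n)"
    by (simp_all add: power_mult)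
  show ?case
    unfolding e qpoch_Suc f Suc.IH [symmetric] by (simp only: mult_ac)
qed simp

lemma qpoch_plus_minus: "qpoch a p n * qpoch (- a) p n = qpoch (a\<^sup>2) (p\<^sup>2) n"
  unfolding qpoch_def prod.distrib [symmetric]
  by (rule prod.cong) (simp_all add: algebra_simps power2_eq_square power_mult_distrib)

theorem corollary4p5:
  fixes q s :: complex and m :: nat
  assumes "0 < norm q" and "norm q < 1" and "s\<^sup>2 = q"
  shows "((\<lambda>n. q ^ (3 * n\<^sup>2 + 2 * m * n) * (-1) ^ n
                / qpochs [q\<^sup>2, - (q ^ (m + 1)), - (q ^ (m + 2))] (q\<^sup>2) n)
           sums
             (1 / qpoch_inf (- (q ^ (m + 1))) q *
               ((-1) ^ m * q powi (- int (m choose 2)) * schur_a m q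
                   / qpochs_inf [q, q ^ 4] (q ^ 5)
                - (-1) ^ m * q powi (- int (m choose 2)) * schur_b m q
                   / qpochs_inf [q\<^sup>2, q ^ 3] (q ^ 5))))
         \<and>
         ((\<lambda>n. q ^ ((3 * n\<^sup>2 - n) div 2 + 2 * m * n)
                / qpochs [q, q ^ m * s, - (q ^ m * s)] q n)
           sums
             ((-1) ^ m * q powi (- (int m * (int m - 1))) / qpoch_inf (q ^ (2 * m + 1)) (q\<^sup>2) *
               (schur_a m (q\<^sup>2) / qpochs_inf [q\<^sup>2, q ^ 8] (q ^ 10)
                - schur_b m (q\<^sup>2) / qpochs_inf [q ^ 4, q ^ 6] (q ^ 10))))"
proof -
  have q: "norm q < 1" "q \<noteq> 0" and q2: "norm (q\<^sup>2) < 1" "q\<^sup>2 \<noteq> 0"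
    using assms by (auto simp: norm_power power_less_one_iff)
  have le: "norm (q ^ (j + 1)) < 1" for j
    using q power_less_one_iff[of "norm q" "Suc j"] by (simp add: norm_power norm_mult)
  show ?thesis
  proof
    define e where "e = qpoch_inf (- (q ^ (m + 1))) q"
    have enz: "e \<noteq> 0" unfolding e_def using le[of m] q by (intro qpoch_inf_nonzero) simp_all
    have t: "alternating_term q m n / e = q ^ (3 * n\<^sup>2 + 2 * m * n) * (-1) ^ n
          / qpochs [q\<^sup>2, - (q ^ (m + 1)), - (q ^ (m + 2))] (q\<^sup>2) n" for n
    proof -
      have s: "e = qpoch (- (q ^ (m + 1))) q (2 * n) * qpoch_inf (- (q ^ (m + 2 * n + 1))) q"
        unfolding e_def using qpoch_inf_split[OF q(1), of "- (q ^ (m + 1))" "2 * n"]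
        by (simp add: power_add mult_ac)
      have "qpoch_inf (- (q ^ (m + 2 * n + 1))) q \<noteq> 0" using s enz by auto
      moreover have "qpochs [q\<^sup>2, - (q ^ (m + 1)), - (q ^ (m + 2))] (q\<^sup>2) n
          = qpoch (q\<^sup>2) (q\<^sup>2) n * qpoch (- (q ^ (m + 1))) q (2 * n)"
        using qpoch_dissect_2[of "- (q ^ (m + 1))" q n] by (simp add: qpochs_def mult_ac)
      ultimately show ?thesis unfolding alternating_term_def s by simp
    qed
    have v: "suminf (alternating_term q m) / e = 1 / e *
               ((-1) ^ m * q powi (- int (m choose 2)) * schur_a m q
                   / qpochs_inf [q, q ^ 4] (q ^ 5)
                - (-1) ^ m * q powi (- int (m choose 2)) * schur_b m q
                   / qpochs_inf [q\<^sup>2, q ^ 3] (q ^ 5))"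
      unfolding rr_solution_unique[OF q alternating_sum_recurrence[OF q(1)] alternating_sum_tendsto[OF q(1)], of m]
      by (simp add: schur_solution_def qpochs_inf_def power_int_minus divide_inverse algebra_simps)
    show "(\<lambda>n. q ^ (3 * n\<^sup>2 + 2 * m * n) * (-1) ^ n
                / qpochs [q\<^sup>2, - (q ^ (m + 1)), - (q ^ (m + 2))] (q\<^sup>2) n)
           sums
             (1 / qpoch_inf (- (q ^ (m + 1))) q *
               ((-1) ^ m * q powi (- int (m choose 2)) * schur_a m q
                   / qpochs_inf [q, q ^ 4] (q ^ 5)
                - (-1) ^ m * q powi (- int (m choose 2)) * schur_b m q
                   / qpochs_inf [q\<^sup>2, q ^ 3] (q ^ 5)))"
      unfolding t [symmetric] e_def [symmetric] v [symmetric]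
      by (intro sums_divide summable_sums summable_alternating_term q)
  next
    define e where "e = qpoch_inf (q ^ (2 * m + 1)) (q\<^sup>2)"
    have enz: "e \<noteq> 0" unfolding e_def using le[of "2 * m"] q2 by (intro qpoch_inf_nonzero)
    have t: "pentagonal_term q m n / e = q ^ ((3 * n\<^sup>2 - n) div 2 + 2 * m * n)
                / qpochs [q, q ^ m * s, - (q ^ m * s)] q n" for n
    proof -
      have t': "q ^ (2 * m + 1) * (q\<^sup>2) ^ n = q ^ (2 * (m + n) + 1)"
        unfolding power_mult [symmetric] power_add [symmetric]
        by (rule arg_cong[where f = "\<lambda>i. q ^ i"]) simp
      have s: "e = qpoch (q ^ (2 * m + 1)) (q\<^sup>2) n * qpoch_inf (q ^ (2 * (m + n) + 1)) (q\<^sup>2)"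
        unfolding e_def using qpoch_inf_split[OF q2(1), of "q ^ (2 * m + 1)" n]
        unfolding t' .
      have "qpoch_inf (q ^ (2 * (m + n) + 1)) (q\<^sup>2) \<noteq> 0" using s enz by auto
      moreover have "(q ^ m * s)\<^sup>2 = q ^ (2 * m + 1)"
        by (simp add: power_mult_distrib assms(3) mult.commute[of m 2] flip: power_mult)
      hence "qpochs [q, q ^ m * s, - (q ^ m * s)] q n
          = qpoch q q n * qpoch (q ^ (2 * m + 1)) (q\<^sup>2) n"
        using qpoch_plus_minus[of "q ^ m * s" q n] by (simp add: qpochs_def mult_ac)
      ultimately show ?thesis unfolding pentagonal_term_def s by simp
    qed
    have ch: "(q\<^sup>2) ^ (m choose 2) = q ^ (m * (m - 1))"
    proof -
      have "even (m * (m - 1))" by (cases m) auto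
      hence "2 * (m choose 2) = m * (m - 1)" by (simp add: choose_two)
      thus ?thesis by (simp add: power_mult [symmetric])
    qed
    have "- (int m * (int m - 1)) = - int (m * (m - 1))"
      by (cases m) (simp_all add: algebra_simps)
    hence ex: "q powi (- (int m * (int m - 1))) = inverse (q ^ (m * (m - 1)))"
      by (simp only: power_int_minus power_int_of_nat)
    have pw: "(q\<^sup>2) ^ 4 = q ^ 8" "(q\<^sup>2) ^ 5 = q ^ 10" "(q\<^sup>2) ^ 2 = q ^ 4" "(q\<^sup>2) ^ 3 = q ^ 6"
      by (simp_all add: power_mult [symmetric])
    have v: "suminf (pentagonal_term q m) / e = (-1) ^ m * q powi (- (int m * (int m - 1))) / e *
               (schur_a m (q\<^sup>2) / qpochs_inf [q\<^sup>2, q ^ 8] (q ^ 10)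
                - schur_b m (q\<^sup>2) / qpochs_inf [q ^ 4, q ^ 6] (q ^ 10))"
      unfolding rr_solution_unique[OF q2 pentagonal_sum_recurrence[OF q(1)] pentagonal_sum_tendsto[OF q(1)], of m]
        ex schur_solution_def pw ch
      by (simp add: qpochs_inf_def divide_inverse algebra_simps)
    show "(\<lambda>n. q ^ ((3 * n\<^sup>2 - n) div 2 + 2 * m * n)
                / qpochs [q, q ^ m * s, - (q ^ m * s)] q n)
           sums
             ((-1) ^ m * q powi (- (int m * (int m - 1))) / qpoch_inf (q ^ (2 * m + 1)) (q\<^sup>2) *
               (schur_a m (q\<^sup>2) / qpochs_inf [q\<^sup>2, q ^ 8] (q ^ 10)
                - schur_b m (q\<^sup>2) / qpochs_inf [q ^ 4, q ^ 6] (q ^ 10)))"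
      unfolding t [symmetric] e_def [symmetric] v [symmetric]
      by (intro sums_divide summable_sums summable_pentagonal_term q)
  qed
qed

end
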